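(* Let $n\in\mathbb{N}$, $n\geq 1$. There exists a constant $C\in(0,\infty)$, depending only on $n$, such that for every set $K\subset\mathbb{R}^{2n+1}$, $$|K|\leq C\prod_{j=1}^{2n}|\pi_j(K)|^{\frac{n+1}{n(2n+1)}}.$$
   Context: Points of $\mathbb{R}^{2n+1}$ (the underlying space of the $n$-th Heisenberg group $\mathbb{H}^n$) are written $(x,t)$ with $x=(x_1,\ldots,x_{2n})\in\mathbb{R}^{2n}$ and $t\in\mathbb{R}$. For $x\in\mathbb{R}^{2n}$, $\hat x_j\in\mathbb{R}^{2n-1}$ denotes the point obtained by deleting the $j$-th coordinate of $x$. The vertical coordinate projections $\pi_1,\ldots,\pi_{2n}:\mathbb{R}^{2n+1}\to\mathbb{R}^{2n}$ are $$\pi_j(x,t)=\big(\hat x_j,\,t+\tfrac12 x_jx_{n+j}\big),\qquad \pi_{n+j}(x,t)=\big(\hat x_{n+j},\,t-\tfrac12 x_jx_{n+j}\big),\qquad j=1,\ldots,n.$$ For $A\subset\mathbb{R}^k$, $|A|$ denotes the $k$-dimensional Lebesgue outer measure (here $k=2n+1$ for $K$ and $k=2n$ for $\pi_j(K)$). Convention: $0\cdot\infty=0$. *)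

theory Defs
  imports "HOL-Analysis.Analysis"
begin

text \<open>
  Since the dimension varies, a vector of \<open>\<real>\<^sup>k\<close> is a function on \<open>{1..k}\<close>, extended by
  \<open>undefined\<close> outside, and \<open>\<real>\<^bsup>k+1\<^esup>\<close> is the set of pairs \<open>(x, t)\<close> with \<open>x\<close> in \<open>\<real>\<^sup>k\<close>
  and \<open>t\<close> real.
\<close>

definition pts :: "nat \<Rightarrow> ((nat \<Rightarrow> real) \<times> real) set" where
  "pts k = ({1..k} \<rightarrow>\<^sub>E UNIV) \<times> UNIV"

definition lborel_xt :: "nat \<Rightarrow> ((nat \<Rightarrow> real) \<times> real) measure" where
  "lborel_xt k = (\<Pi>\<^sub>M i\<in>{1..k}. lborel) \<Otimes>\<^sub>M lborel"

lemma space_lborel_xt: "space (lborel_xt k) = pts k"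
  by (simp add: lborel_xt_def pts_def space_pair_measure space_PiM)

text \<open>
  Lebesgue outer measure on \<open>\<real>\<^bsup>k+1\<^esup>\<close>: the infimum of the measures of the Borel supersets. Lebesgue
  measurable supersets give the same value, because each of them is contained in a Borel set of
  equal measure.
\<close>

definition leb_outer :: "nat \<Rightarrow> ((nat \<Rightarrow> real) \<times> real) set \<Rightarrow> ennreal" where
  "leb_outer k A = outer_measure_of (lborel_xt k) A"

text \<open>Deletes the \<open>j\<close>-th of \<open>m\<close> coordinates; the later ones move down by one.\<close>

definition del_coord :: "nat \<Rightarrow> nat \<Rightarrow> (nat \<Rightarrow> real) \<Rightarrow> nat \<Rightarrow> real" where
  "del_coord m j x = (\<lambda>i\<in>{1..m - 1}. x (if i < j then i else i + 1))"

text \<open>The two cases are \<open>\<pi>\<^sub>j\<close> and \<open>\<pi>\<^bsub>n+j\<^esub>\<close> for \<open>j = 1, \<dots>, n\<close>; in the second one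
  \<open>j\<close> is the index \<open>i - n\<close>.\<close>

definition vproj :: "nat \<Rightarrow> nat \<Rightarrow> (nat \<Rightarrow> real) \<times> real \<Rightarrow> (nat \<Rightarrow> real) \<times> real" where
  "vproj n i = (\<lambda>(x, t).
     if i \<le> n then (del_coord (2 * n) i x, t + 1 / 2 * x i * x (n + i))
     else (del_coord (2 * n) i x, t - 1 / 2 * x (i - n) * x i))"

lemma vproj_mem_pts: "vproj n i p \<in> pts (2 * n - 1)"
  by (cases p) (auto simp: vproj_def pts_def del_coord_def)

text \<open>Powers of elements of \<open>[0, \<infinity>]\<close>; only meant for exponents \<open>p > 0\<close>.\<close>

definition ennpowr :: "ennreal \<Rightarrow> real \<Rightarrow> ennreal" where
  "ennpowr a p = (if a = \<infinity> then \<infinity> else ennreal (enn2real a powr p))"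

end

theory Submission
  imports Defs
begin

text \<open>
  For \<open>n = 1\<close> the points of \<open>\<pi>\<^sub>1(K)\<close> and \<open>\<pi>\<^sub>2(K)\<close> can be read as points and lines of the plane and
  those of \<open>K\<close> as incidences. If \<open>R(a, b)\<close> is the length (in the first coordinate) of the part of the
  line \<open>y = a u + b\<close> in a planar set \<open>A\<close>, then \<open>\<integral> R\<^sup>3 \<le> 3 |A|\<^sup>2\<close>: expand the cube into an integral over
  triples of points on a line, integrate out the middle one, at the cost of a factor \<open>|u - v|\<close> where
  \<open>u\<close>, \<open>v\<close> are the outer ones, and note that this factor is the Jacobian of the passage from
  \<open>(a, b, u, v)\<close> to a pair of points. Hoelder's inequality gives the case \<open>n = 1\<close>.

  For the step from \<open>n - 1\<close> to \<open>n\<close>, fix \<open>k\<close> and slice \<open>K\<close> along \<open>z = (x\<^sub>k, x\<^bsub>n+k\<^esub>)\<close>. A slice is bounded by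
  the induction hypothesis, and also by the slices of \<open>\<pi>\<^sub>k(K)\<close> and \<open>\<pi>\<^bsub>n+k\<^esub>(K)\<close>, up to a translation
  in \<open>t\<close>. Interpolating these bounds with weights \<open>(2n-1)/(2n+1)\<close>, \<open>1/(2n+1)\<close>, \<open>1/(2n+1)\<close> makes
  Hoelder's inequality in \<open>z\<close> applicable. The geometric mean over \<open>k\<close> of the resulting inequalities
  is symmetric in the projections.
\<close>

subsection \<open>Powers of extended nonnegative reals and Hoelder's inequality\<close>

lemma ennpowr_top [simp]: "ennpowr top p = top"
  by (simp add: ennpowr_def)

lemma ennpowr_ennreal: "0 \<le> x \<Longrightarrow> ennpowr (ennreal x) p = ennreal (x powr p)"
  by (simp add: ennpowr_def)

lemma ennpowr_0 [simp]: "ennpowr 0 p = 0"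
  by (simp add: ennpowr_def)

lemma ennpowr_1 [simp]: "ennpowr a 1 = a"
  by (cases a) (simp_all add: ennpowr_ennreal)

lemma ennpowr_one [simp]: "ennpowr 1 p = 1"
  by (simp add: ennpowr_def)

lemma ennpowr_eq_0_iff [simp]: "ennpowr a p = 0 \<longleftrightarrow> a = 0"
  by (cases a) (simp_all add: ennpowr_ennreal)

lemma ennpowr_mono: "a \<le> b \<Longrightarrow> 0 \<le> p \<Longrightarrow> ennpowr a p \<le> ennpowr b p"
  by (cases a; cases b) (auto simp: ennpowr_ennreal top_unique intro!: ennreal_leI powr_mono2)

lemma ennpowr_mult: "ennpowr (a * b) p = ennpowr a p * ennpowr b p"
proof (cases "a = 0 \<or> b = 0")
  case False
  then show ?thesis
    by (cases a; cases b)
       (auto simp: ennpowr_ennreal powr_mult ennreal_mult_top ennreal_top_mult simp flip: ennreal_mult)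
qed auto

lemma ennpowr_prod: "ennpowr (\<Prod>i\<in>I. f i) p = (\<Prod>i\<in>I. ennpowr (f i) p)"
  by (induction I rule: infinite_finite_induct) (auto simp: ennpowr_mult)

lemma ennpowr_add: "ennpowr a (p + q) = ennpowr a p * ennpowr a q"
  by (cases a) (auto simp: ennpowr_ennreal powr_add ennreal_mult)

lemma ennpowr_sum: "finite I \<Longrightarrow> I \<noteq> {} \<Longrightarrow> ennpowr a (\<Sum>i\<in>I. p i) = (\<Prod>i\<in>I. ennpowr a (p i))"
  by (induction I rule: finite_ne_induct) (auto simp: ennpowr_add)

lemma ennpowr_ennpowr: "ennpowr (ennpowr a p) q = ennpowr a (p * q)"
  by (cases a) (auto simp: ennpowr_ennreal powr_powr)

lemma ennpowr_numeral: "ennpowr a (numeral k) = a ^ numeral k"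
proof (cases "a = 0")
  case False
  then show ?thesis
    by (cases a) (auto simp: ennpowr_ennreal powr_numeral ennreal_power power_eq_top_ennreal_iff)
qed auto

lemma ennpowr_le_self: "1 \<le> a \<Longrightarrow> p \<le> 1 \<Longrightarrow> ennpowr a p \<le> a"
  using powr_mono[of p 1 "enn2real a"]
  by (cases a) (auto simp: ennpowr_ennreal intro!: ennreal_leI)

lemma measurable_ennpowr [measurable]:
  assumes [measurable]: "f \<in> borel_measurable M"
  shows "(\<lambda>x. ennpowr (f x) p) \<in> borel_measurable M"
  unfolding ennpowr_def by measurable

text \<open>Jensen's inequality for exp at the points ln (x i) settles the case of positive finite
  entries. An infinite entry makes the right side infinite because every weight is positive; a zero
  entry makes the left side vanish.\<close>

lemma weighted_arith_geo_mean_ennreal: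
  fixes x :: "'i \<Rightarrow> ennreal"
  assumes "finite I" and p: "\<And>i. i \<in> I \<Longrightarrow> p i > 0" and "sum p I = 1"
  shows "(\<Prod>i\<in>I. ennpowr (x i) (p i)) \<le> (\<Sum>i\<in>I. ennreal (p i) * x i)"
proof -
  consider (top) i where "i \<in> I" "x i = top" | (zero) i where "i \<in> I" "x i = 0"
    | (pos) "\<And>i. i \<in> I \<Longrightarrow> x i \<noteq> top \<and> x i \<noteq> 0"
    by blast
  then show ?thesis
  proof cases
    case top
    then have "\<exists>i\<in>I. ennreal (p i) * x i = top"
      using p[of i] by (intro bexI[of _ i]) (simp_all add: ennreal_mult_top)
    with \<open>finite I\<close> have "(\<Sum>i\<in>I. ennreal (p i) * x i) = top"
      by auto
    then show ?thesis by simp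
  next
    case zero
    then have "(\<Prod>i\<in>I. ennpowr (x i) (p i)) = 0"
      using \<open>finite I\<close> by auto
    then show ?thesis by (metis zero_le)
  next
    case pos
    define y where "y i = enn2real (x i)" for i
    have y: "y i > 0" "x i = ennreal (y i)" if "i \<in> I" for i
      using pos[OF that] by (auto simp: y_def enn2real_positive_iff less_top zero_less_iff_neq_zero)
    have "(\<Prod>i\<in>I. ennpowr (x i) (p i)) = ennreal (\<Prod>i\<in>I. y i powr p i)"
      using y by (simp add: ennpowr_ennreal less_imp_le flip: prod_ennreal)
    also have "(\<Prod>i\<in>I. y i powr p i) = exp (\<Sum>i\<in>I. p i * ln (y i))"
      using y(1) \<open>finite I\<close> by (auto simp: exp_sum powr_def less_le intro!: prod.cong)
    also have "\<dots> \<le> (\<Sum>i\<in>I. p i * exp (ln (y i)))"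
    proof -
      have "I \<noteq> {}"
        using \<open>sum p I = 1\<close> by auto
      then show ?thesis
        using convex_on_sum[of I UNIV exp p "\<lambda>i. ln (y i)"] assms
        by (auto simp: less_imp_le exp_convex)
    qed
    also have "\<dots> = (\<Sum>i\<in>I. p i * y i)"
      using y by (intro sum.cong) auto
    also have "ennreal \<dots> = (\<Sum>i\<in>I. ennreal (p i) * x i)"
      using y p by (simp add: less_imp_le flip: ennreal_mult sum_ennreal)
    finally show ?thesis by (simp add: ennreal_leI)
  qed
qed

text \<open>Divided by its integral \<open>N i\<close>, each function has integral 1. The weighted
  arithmetic-geometric mean inequality is applied pointwise to the quotients, and its right side
  integrates to \<open>sum p I = 1\<close>.\<close>

lemma nn_integral_Holder_prod:
  assumes I: "finite I" and p: "\<And>i. i \<in> I \<Longrightarrow> p i > 0" and p1: "sum p I = 1"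
    and f [measurable]: "\<And>i. i \<in> I \<Longrightarrow> f i \<in> borel_measurable M"
  shows "(\<integral>\<^sup>+x. (\<Prod>i\<in>I. ennpowr (f i x) (p i)) \<partial>M) \<le> (\<Prod>i\<in>I. ennpowr (\<integral>\<^sup>+x. f i x \<partial>M) (p i))"
proof -
  define N where "N i = (\<integral>\<^sup>+x. f i x \<partial>M)" for i
  \<comment> \<open>Since 0 * infinity = 0, an infinite integral makes the right side infinite only
    when no other integral vanishes; hence the extra condition in the case
    \<open>top\<close>.\<close>
  consider (zero) i where "i \<in> I" "N i = 0"
    | (top) i where "i \<in> I" "N i = top" "\<And>i. i \<in> I \<Longrightarrow> N i \<noteq> 0"
    | (pos) "\<And>i. i \<in> I \<Longrightarrow> N i \<noteq> top \<and> N i \<noteq> 0"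
    by blast
  then show ?thesis
  proof cases
    case zero
    then have "AE x in M. f i x = 0"
      by (subst (asm) N_def, subst (asm) nn_integral_0_iff_AE) auto
    then have "AE x in M. (\<Prod>i\<in>I. ennpowr (f i x) (p i)) = 0"
      by eventually_elim (use I zero in auto)
    then have "(\<integral>\<^sup>+x. (\<Prod>i\<in>I. ennpowr (f i x) (p i)) \<partial>M) = (\<integral>\<^sup>+x. 0 \<partial>M)"
      by (intro nn_integral_cong_AE)
    then show ?thesis by simp
  next
    case top
    have "(\<Prod>i\<in>I. ennpowr (N i) (p i)) = ennpowr (N i) (p i) * (\<Prod>i\<in>I - {i}. ennpowr (N i) (p i))"
      using I top by (intro prod.remove) auto
    also have "\<dots> = top"
      using I top by (auto simp: ennreal_top_mult)
    finally show ?thesis by (simp add: N_def)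
  next
    case pos
    have eq: "ennpowr (f i x) (p i) = ennpowr (N i) (p i) * ennpowr (f i x / N i) (p i)"
      if "i \<in> I" for i x
      using pos[OF that]
      by (simp add: ennreal_times_divide mult_divide_eq_ennreal mult.commute[of "N i"] flip: ennpowr_mult)
    have "(\<integral>\<^sup>+x. (\<Prod>i\<in>I. ennpowr (f i x) (p i)) \<partial>M) =
        (\<integral>\<^sup>+x. (\<Prod>i\<in>I. ennpowr (N i) (p i)) * (\<Prod>i\<in>I. ennpowr (f i x / N i) (p i)) \<partial>M)"
      using eq by (intro nn_integral_cong) (simp flip: prod.distrib)
    also have "\<dots> \<le> (\<integral>\<^sup>+x. (\<Prod>i\<in>I. ennpowr (N i) (p i)) * (\<Sum>i\<in>I. ennreal (p i) * (f i x / N i)) \<partial>M)"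
      using I p p1 by (intro nn_integral_mono mult_left_mono weighted_arith_geo_mean_ennreal) auto
    also have "\<dots> = (\<Prod>i\<in>I. ennpowr (N i) (p i)) * (\<Sum>i\<in>I. ennreal (p i) * (N i / N i))"
      by (simp add: nn_integral_cmult nn_integral_sum nn_integral_divide N_def)
    also have "(\<Sum>i\<in>I. ennreal (p i) * (N i / N i)) = (\<Sum>i\<in>I. ennreal (p i))"
      using pos by (intro sum.cong) (auto simp: ennreal_divide_self less_top)
    also have "\<dots> = 1"
      using p p1 by (simp add: less_imp_le)
    finally show ?thesis by (simp add: N_def)
  qed
qed

subsection \<open>Incidences in the plane\<close>

abbreviation lborel2 :: "(real \<times> real) measure" where
  "lborel2 \<equiv> lborel \<Otimes>\<^sub>M lborel"

text \<open>This is \<open>R(a, b)\<close> for \<open>z = (a, b)\<close>: the slope comes first,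
  then the intercept.\<close>

definition line_integral :: "(real \<times> real) set \<Rightarrow> real \<times> real \<Rightarrow> ennreal" where
  "line_integral A z = (\<integral>\<^sup>+u. indicator A (u, snd z + fst z * u) \<partial>lborel)"

lemma measurable_line_integral [measurable]:
  assumes [measurable]: "A \<in> sets lborel2"
  shows "line_integral A \<in> borel_measurable lborel2"
  unfolding line_integral_def by measurable

lemma nn_integral_lborel_shift:
  fixes c :: real
  assumes [measurable]: "f \<in> borel_measurable borel"
  shows "(\<integral>\<^sup>+x. f (x + c) \<partial>lborel) = (\<integral>\<^sup>+x. f x \<partial>lborel)"
  using nn_integral_real_affine[OF assms, of 1 c] by (simp add: add.commute)

text \<open>The map taking (a, b) to (a u + b, a v + b) is linear with Jacobian |u - v|, so for
  distinct u and v both sides agree. For u = v the left side is 0 by the convention 0 * infinity =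
  0.\<close>

lemma nn_integral_lines_two_points:
  assumes A [measurable]: "A \<in> sets lborel2"
  shows "ennreal \<bar>u - v\<bar> * (\<integral>\<^sup>+z. indicator A (u, snd z + fst z * u) * indicator A (v, snd z + fst z * v) \<partial>lborel2)
    \<le> (\<integral>\<^sup>+y. indicator A (u, y) \<partial>lborel) * (\<integral>\<^sup>+y. indicator A (v, y) \<partial>lborel)"
proof (cases "u = v")
  case False
  have "(\<integral>\<^sup>+z. indicator A (u, snd z + fst z * u) * indicator A (v, snd z + fst z * v) \<partial>lborel2) =
      (\<integral>\<^sup>+a. \<integral>\<^sup>+b. indicator A (u, b + a * u) * indicator A (v, b + a * v) \<partial>lborel \<partial>lborel)"
    by (subst lborel.nn_integral_fst[symmetric]) auto
  \<comment> \<open>The translation of \<open>b\<close> by \<open>a * u\<close> leaves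
    \<open>a\<close> in the second factor only.\<close>
  also have "\<dots> = (\<integral>\<^sup>+a. \<integral>\<^sup>+b. indicator A (u, b) * indicator A (v, b + a * (v - u)) \<partial>lborel \<partial>lborel)"
  proof (rule nn_integral_cong)
    fix a :: real
    show "(\<integral>\<^sup>+b. indicator A (u, b + a * u) * indicator A (v, b + a * v) \<partial>lborel) =
      (\<integral>\<^sup>+b. indicator A (u, b) * indicator A (v, b + a * (v - u)) \<partial>lborel :: ennreal)"
      by (subst nn_integral_lborel_shift[of _ "a * u", symmetric]) (auto simp: algebra_simps)
  qed
  also have "\<dots> = (\<integral>\<^sup>+b. \<integral>\<^sup>+a. indicator A (u, b) * indicator A (v, b + a * (v - u)) \<partial>lborel \<partial>lborel)"
    by (rule lborel_pair.Fubini'[symmetric]) measurable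
  also have "\<dots> = (\<integral>\<^sup>+b. indicator A (u, b) * (\<integral>\<^sup>+a. indicator A (v, b + a * (v - u)) \<partial>lborel) \<partial>lborel)"
    by (simp add: nn_integral_cmult)
  finally have "ennreal \<bar>u - v\<bar> *
      (\<integral>\<^sup>+z. indicator A (u, snd z + fst z * u) * indicator A (v, snd z + fst z * v) \<partial>lborel2) =
      (\<integral>\<^sup>+b. indicator A (u, b) * (ennreal \<bar>v - u\<bar> * (\<integral>\<^sup>+a. indicator A (v, b + (v - u) * a) \<partial>lborel)) \<partial>lborel)"
    by (simp flip: nn_integral_cmult add: ac_simps abs_minus_commute)
  also have "\<dots> = (\<integral>\<^sup>+b. indicator A (u, b) * (\<integral>\<^sup>+y. indicator A (v, y) \<partial>lborel) \<partial>lborel)"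
  proof (rule nn_integral_cong)
    fix b :: real
    show "indicator A (u, b) * (ennreal \<bar>v - u\<bar> * (\<integral>\<^sup>+a. indicator A (v, b + (v - u) * a) \<partial>lborel)) =
      indicator A (u, b) * (\<integral>\<^sup>+y. indicator A (v, y) \<partial>lborel)"
      using False by (subst nn_integral_real_affine[of "\<lambda>y. indicator A (v, y)" "v - u" b]) auto
  qed
  also have "\<dots> = (\<integral>\<^sup>+y. indicator A (u, y) \<partial>lborel) * (\<integral>\<^sup>+y. indicator A (v, y) \<partial>lborel)"
    by (simp add: nn_integral_multc)
  finally show ?thesis by simp
qed simp

text \<open>Among three points on a line one lies between the other two. Dropping the condition that
  this point be in \<open>A\<close> and integrating it over the interval between the others yields
  |u - v|; the factor 3 counts which of the three is in the middle.\<close>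

lemma line_integral_cube_le:
  assumes A [measurable]: "A \<in> sets lborel2"
  shows "line_integral A z ^ 3 \<le>
    3 * (\<integral>\<^sup>+w. ennreal \<bar>fst w - snd w\<bar> *
      (indicator A (fst w, snd z + fst z * fst w) * indicator A (snd w, snd z + fst z * snd w)) \<partial>lborel2)"
    (is "_ \<le> 3 * ?G")
proof -
  define \<phi> :: "real \<Rightarrow> ennreal" where "\<phi> u = indicator A (u, snd z + fst z * u)" for u
  define b :: "real \<Rightarrow> real \<Rightarrow> real \<Rightarrow> ennreal"
    where "b u v w = \<phi> u * \<phi> v * indicator {min u v..max u v} w" for u v w
  have [measurable]: "\<phi> \<in> borel_measurable borel"
    unfolding \<phi>_def by measurable
  have meas [measurable]: "(\<lambda>x. b (f x) (g x) (h x)) \<in> borel_measurable M"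
    if [measurable]: "f \<in> borel_measurable M" "g \<in> borel_measurable M" "h \<in> borel_measurable M"
    for f g h and M :: "'x measure"
    unfolding b_def indicator_def atLeastAtMost_iff by measurable
  have G: "(\<integral>\<^sup>+u. \<integral>\<^sup>+v. \<integral>\<^sup>+w. b u v w \<partial>lborel \<partial>lborel \<partial>lborel) = ?G"
  proof -
    have "(\<integral>\<^sup>+w. b u v w \<partial>lborel) = ennreal \<bar>u - v\<bar> * (\<phi> u * \<phi> v)" for u v
      by (simp add: b_def nn_integral_cmult emeasure_lborel_Icc_eq mult.commute max_def min_def abs_if)
    then show ?thesis
      by (subst lborel.nn_integral_fst[symmetric]) (auto simp: \<phi>_def)
  qed
  have "line_integral A z ^ 3 = (\<integral>\<^sup>+u. \<integral>\<^sup>+v. \<integral>\<^sup>+w. \<phi> u * \<phi> v * \<phi> w \<partial>lborel \<partial>lborel \<partial>lborel)"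
    by (simp add: line_integral_def nn_integral_cmult nn_integral_multc power3_eq_cube flip: \<phi>_def)
  \<comment> \<open>The summands treat the cases that \<open>w\<close>, \<open>v\<close>,
    \<open>u\<close>, respectively, is in the middle; wherever the product is nonzero, at least one
    of them is 1.\<close>
  also have "\<dots> \<le> (\<integral>\<^sup>+u. \<integral>\<^sup>+v. \<integral>\<^sup>+w. b u v w + b u w v + b v w u \<partial>lborel \<partial>lborel \<partial>lborel)"
    by (intro nn_integral_mono) (auto simp: b_def \<phi>_def indicator_def)
  also have "\<dots> = (\<integral>\<^sup>+u. \<integral>\<^sup>+v. \<integral>\<^sup>+w. b u v w \<partial>lborel \<partial>lborel \<partial>lborel) +
      (\<integral>\<^sup>+u. \<integral>\<^sup>+v. \<integral>\<^sup>+w. b u w v \<partial>lborel \<partial>lborel \<partial>lborel) +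
      (\<integral>\<^sup>+u. \<integral>\<^sup>+v. \<integral>\<^sup>+w. b v w u \<partial>lborel \<partial>lborel \<partial>lborel)"
    by (simp add: nn_integral_add)
  also have "(\<integral>\<^sup>+u. \<integral>\<^sup>+v. \<integral>\<^sup>+w. b u w v \<partial>lborel \<partial>lborel \<partial>lborel) = ?G"
    unfolding G[symmetric] by (intro nn_integral_cong lborel_pair.Fubini') measurable
  also have "(\<integral>\<^sup>+u. \<integral>\<^sup>+v. \<integral>\<^sup>+w. b v w u \<partial>lborel \<partial>lborel \<partial>lborel) =
      (\<integral>\<^sup>+v. \<integral>\<^sup>+u. \<integral>\<^sup>+w. b v w u \<partial>lborel \<partial>lborel \<partial>lborel)"
    by (intro lborel_pair.Fubini') measurable
  also have "\<dots> = ?G"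
    unfolding G[symmetric] by (intro nn_integral_cong lborel_pair.Fubini') measurable
  finally have "line_integral A z ^ 3 \<le> ?G + ?G + ?G"
    by (simp only: G)
  also have "?G + ?G + ?G = (1 + 1 + 1) * ?G"
    by (simp only: distrib_right mult_1)
  finally show ?thesis by simp
qed

text \<open>Fubini puts the integral over the lines inside that over the pairs (u, v). There the
  factor |u - v| cancels the Jacobian, and what is left factors into two copies of |A|.\<close>

lemma nn_integral_line_integral_cube:
  assumes A [measurable]: "A \<in> sets lborel2"
  shows "(\<integral>\<^sup>+z. line_integral A z ^ 3 \<partial>lborel2) \<le> 3 * (emeasure lborel2 A)\<^sup>2"
proof -
  interpret P: pair_sigma_finite lborel2 lborel2
    by standard
  define H :: "real \<times> real \<Rightarrow> real \<times> real \<Rightarrow> ennreal" where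
    "H z w = indicator A (fst w, snd z + fst z * fst w) * indicator A (snd w, snd z + fst z * snd w)" for z w
  have "(\<integral>\<^sup>+z. line_integral A z ^ 3 \<partial>lborel2) \<le>
      (\<integral>\<^sup>+z. 3 * (\<integral>\<^sup>+w. ennreal \<bar>fst w - snd w\<bar> * H z w \<partial>lborel2) \<partial>lborel2)"
    unfolding H_def by (intro nn_integral_mono line_integral_cube_le A)
  also have "\<dots> = 3 * (\<integral>\<^sup>+z. \<integral>\<^sup>+w. ennreal \<bar>fst w - snd w\<bar> * H z w \<partial>lborel2 \<partial>lborel2)"
    by (intro nn_integral_cmult) (simp add: H_def)
  also have "(\<integral>\<^sup>+z. \<integral>\<^sup>+w. ennreal \<bar>fst w - snd w\<bar> * H z w \<partial>lborel2 \<partial>lborel2) =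
      (\<integral>\<^sup>+w. \<integral>\<^sup>+z. ennreal \<bar>fst w - snd w\<bar> * H z w \<partial>lborel2 \<partial>lborel2)"
    by (intro P.Fubini') (simp add: H_def)
  also have "\<dots> = (\<integral>\<^sup>+w. ennreal \<bar>fst w - snd w\<bar> * (\<integral>\<^sup>+z. H z w \<partial>lborel2) \<partial>lborel2)"
    by (intro nn_integral_cong nn_integral_cmult) (simp add: H_def)
  also have "\<dots> \<le> (\<integral>\<^sup>+w. (\<integral>\<^sup>+y. indicator A (fst w, y) \<partial>lborel) * (\<integral>\<^sup>+y. indicator A (snd w, y) \<partial>lborel) \<partial>lborel2)"
    unfolding H_def by (intro nn_integral_mono nn_integral_lines_two_points A)
  also have "\<dots> = (\<integral>\<^sup>+u. \<integral>\<^sup>+y. indicator A (u, y) \<partial>lborel \<partial>lborel)\<^sup>2"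
    by (subst lborel.nn_integral_fst[symmetric])
       (auto simp: nn_integral_cmult nn_integral_multc power2_eq_square)
  also have "(\<integral>\<^sup>+u. \<integral>\<^sup>+y. indicator A (u, y) \<partial>lborel \<partial>lborel) = emeasure lborel2 A"
    by (subst lborel.nn_integral_fst) (simp_all add: nn_integral_indicator[OF A])
  finally show ?thesis by (simp add: mult_left_mono)
qed

text \<open>Hoelder's inequality with weight 2/3 for the indicator of \<open>B\<close> and 1/3 for
  the cube of \<open>line_integral A\<close>, whose integral is at most quadratic in |A|.\<close>

lemma nn_integral_incidences:
  assumes A [measurable]: "A \<in> sets lborel2" and B [measurable]: "B \<in> sets lborel2"
  shows "(\<integral>\<^sup>+z. indicator B z * line_integral A z \<partial>lborel2)
    \<le> 3 * (ennpowr (emeasure lborel2 A) (2/3) * ennpowr (emeasure lborel2 B) (2/3))"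
proof -
  \<comment> \<open>The two Hoelder factors are indexed by \<open>bool\<close>: \<open>True\<close>
    stands for \<open>B\<close>, \<open>False\<close> for the cube.\<close>
  define f where "f i = (if i then indicator B else (\<lambda>z. line_integral A z ^ 3))" for i
  define p where "p i = (if i then 2/3 else 1/3 :: real)" for i
  have "(\<integral>\<^sup>+z. indicator B z * line_integral A z \<partial>lborel2) =
      (\<integral>\<^sup>+z. (\<Prod>i\<in>UNIV. ennpowr (f i z) (p i)) \<partial>lborel2)"
    by (intro nn_integral_cong)
       (auto simp: UNIV_bool f_def p_def indicator_def ennpowr_ennpowr simp flip: ennpowr_numeral)
  also have "\<dots> \<le> (\<Prod>i\<in>UNIV. ennpowr (\<integral>\<^sup>+z. f i z \<partial>lborel2) (p i))"
    by (intro nn_integral_Holder_prod) (auto simp: p_def f_def UNIV_bool)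
  also have "\<dots> = ennpowr (emeasure lborel2 B) (2/3) * ennpowr (\<integral>\<^sup>+z. line_integral A z ^ 3 \<partial>lborel2) (1/3)"
    by (simp add: UNIV_bool f_def p_def mult.commute nn_integral_indicator[OF B])
  also have "\<dots> \<le> ennpowr (emeasure lborel2 B) (2/3) * ennpowr (3 * (emeasure lborel2 A)\<^sup>2) (1/3)"
    by (intro mult_left_mono ennpowr_mono nn_integral_line_integral_cube A) auto
  also have "ennpowr (3 * (emeasure lborel2 A)\<^sup>2) (1/3) = ennpowr 3 (1/3) * ennpowr (emeasure lborel2 A) (2/3)"
    by (simp add: ennpowr_mult ennpowr_ennpowr flip: ennpowr_numeral)
  \<comment> \<open>The cube root of 3 is rounded up to 3, the constant that the induction carries
    along.\<close>
  also have "ennpowr (emeasure lborel2 B) (2/3) * (ennpowr 3 (1/3) * ennpowr (emeasure lborel2 A) (2/3)) \<le>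
      ennpowr (emeasure lborel2 B) (2/3) * (3 * ennpowr (emeasure lborel2 A) (2/3))"
    by (intro mult_left_mono mult_right_mono ennpowr_le_self) auto
  finally show ?thesis
    by (simp only: ac_simps)
qed

subsection \<open>Slicing\<close>

text \<open>An arbitrary index set allows coordinates to be removed and put back without renumbering
  the others.\<close>

definition lborel_I :: "nat set \<Rightarrow> ((nat \<Rightarrow> real) \<times> real) measure" where
  "lborel_I I = (\<Pi>\<^sub>M i\<in>I. lborel) \<Otimes>\<^sub>M lborel"

interpretation lborel_prod: product_sigma_finite "\<lambda>_::nat. lborel :: real measure"
  by standard

lemma space_lborel_I: "space (lborel_I I) = (I \<rightarrow>\<^sub>E UNIV) \<times> UNIV"
  by (simp add: lborel_I_def space_pair_measure space_PiM)

lemma sigma_finite_lborel_I: "finite I \<Longrightarrow> sigma_finite_measure (lborel_I I)"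
  unfolding lborel_I_def
  by (intro sigma_finite_pair_measure lborel_prod.sigma_finite sigma_finite_lborel)

lemma measurable_lborel_I_upd:
  "(\<lambda>(a, p). ((fst p)(i := a), snd p)) \<in> borel \<Otimes>\<^sub>M lborel_I I \<rightarrow>\<^sub>M lborel_I (insert i I)"
  unfolding lborel_I_def split_beta
  by (intro measurable_Pair measurable_fun_upd[where J = I]) auto

lemma nn_integral_lborel_I_insert:
  assumes I: "finite I" "i \<notin> I" and f [measurable]: "f \<in> borel_measurable (lborel_I (insert i I))"
  shows "integral\<^sup>N (lborel_I (insert i I)) f =
    (\<integral>\<^sup>+a. \<integral>\<^sup>+p. f ((fst p)(i := a), snd p) \<partial>lborel_I I \<partial>lborel)"
proof -
  note [measurable] = f[unfolded lborel_I_def]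
  have "integral\<^sup>N (lborel_I (insert i I)) f =
      (\<integral>\<^sup>+x. \<integral>\<^sup>+t. f (x, t) \<partial>lborel \<partial>(\<Pi>\<^sub>M i\<in>insert i I. lborel))"
    unfolding lborel_I_def by (intro lborel.nn_integral_fst[symmetric]) measurable
  also have "\<dots> = (\<integral>\<^sup>+a. \<integral>\<^sup>+x. \<integral>\<^sup>+t. f (x(i := a), t) \<partial>lborel \<partial>(\<Pi>\<^sub>M i\<in>I. lborel) \<partial>lborel)"
    by (intro lborel_prod.product_nn_integral_insert_rev I) measurable
  also have "\<dots> = (\<integral>\<^sup>+a. \<integral>\<^sup>+p. f ((fst p)(i := a), snd p) \<partial>lborel_I I \<partial>lborel)"
    unfolding lborel_I_def
    by (intro nn_integral_cong, subst lborel.nn_integral_fst[symmetric]) auto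
  finally show ?thesis .
qed

text \<open>The product over no indices is a single point of mass 1, the constant
  \<open>undefined\<close>.\<close>

lemma nn_integral_lborel_I_empty:
  assumes f [measurable]: "f \<in> borel_measurable (lborel_I {})"
  shows "integral\<^sup>N (lborel_I {}) f = (\<integral>\<^sup>+t. f (\<lambda>_. undefined, t) \<partial>lborel)"
proof -
  note [measurable] = f[unfolded lborel_I_def]
  have "integral\<^sup>N (lborel_I {}) f = (\<integral>\<^sup>+x. \<integral>\<^sup>+t. f (x, t) \<partial>lborel \<partial>(\<Pi>\<^sub>M i\<in>{}. lborel))"
    unfolding lborel_I_def by (intro lborel.nn_integral_fst[symmetric]) measurable
  then show ?thesis
    by (simp add: PiM_empty nn_integral_count_space_finite)
qed

lemma nn_integral_lborel_I_shift:
  assumes f [measurable]: "f \<in> borel_measurable (lborel_I I)"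
  shows "(\<integral>\<^sup>+p. f (fst p, snd p + c) \<partial>lborel_I I) = integral\<^sup>N (lborel_I I) f"
proof -
  note [measurable] = f[unfolded lborel_I_def]
  have "(\<integral>\<^sup>+p. f (fst p, snd p + c) \<partial>lborel_I I) =
      (\<integral>\<^sup>+x. \<integral>\<^sup>+t. f (x, t + c) \<partial>lborel \<partial>(\<Pi>\<^sub>M i\<in>I. lborel))"
    unfolding lborel_I_def by (subst lborel.nn_integral_fst[symmetric]) auto
  also have "\<dots> = (\<integral>\<^sup>+x. \<integral>\<^sup>+t. f (x, t) \<partial>lborel \<partial>(\<Pi>\<^sub>M i\<in>I. lborel))"
    by (intro nn_integral_cong nn_integral_lborel_shift) simp
  also have "\<dots> = integral\<^sup>N (lborel_I I) f"
    unfolding lborel_I_def by (intro lborel.nn_integral_fst) measurable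
  finally show ?thesis .
qed

text \<open>With both coordinates of a pair fixed, the projection along either of them acts on the
  rest as a translation in \<open>t\<close>; this lemma makes such translations harmless.\<close>

lemma emeasure_lborel_I_shift:
  assumes "E \<in> sets (lborel_I L)"
  shows "emeasure (lborel_I L) {p \<in> space (lborel_I L). (fst p, snd p + c) \<in> E} = emeasure (lborel_I L) E"
proof -
  have [measurable]: "(\<lambda>p. (fst p, snd p + c)) \<in> lborel_I L \<rightarrow>\<^sub>M lborel_I L"
    unfolding lborel_I_def by measurable
  note [measurable] = assms
  have "emeasure (lborel_I L) E = (\<integral>\<^sup>+p. indicator E (fst p, snd p + c) \<partial>lborel_I L)"
    using nn_integral_lborel_I_shift[of "indicator E" L c] by simp
  also have "\<dots> = (\<integral>\<^sup>+p. indicator {p \<in> space (lborel_I L). (fst p, snd p + c) \<in> E} p \<partial>lborel_I L)"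
    by (intro nn_integral_cong) (auto simp: indicator_def)
  also have "\<dots> = emeasure (lborel_I L) {p \<in> space (lborel_I L). (fst p, snd p + c) \<in> E}"
    by (intro nn_integral_indicator) measurable
  finally show ?thesis ..
qed

definition slice :: "nat set \<Rightarrow> nat \<Rightarrow> ((nat \<Rightarrow> real) \<times> real) set \<Rightarrow> real \<Rightarrow> ((nat \<Rightarrow> real) \<times> real) set" where
  "slice I i A a = {p \<in> space (lborel_I I). ((fst p)(i := a), snd p) \<in> A}"

lemma sets_slice [measurable]:
  assumes [measurable]: "A \<in> sets (lborel_I (insert i I))"
  shows "slice I i A a \<in> sets (lborel_I I)"
proof -
  have [measurable]: "(\<lambda>p. ((fst p)(i := a), snd p)) \<in> lborel_I I \<rightarrow>\<^sub>M lborel_I (insert i I)"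
    using measurable_compose[OF _ measurable_lborel_I_upd[of i I], of "\<lambda>p. (a, p)" "lborel_I I"]
    by simp
  show ?thesis
    unfolding slice_def by measurable
qed

text \<open>The slices are the sections of one measurable set in the product with the real line, so
  sigma-finiteness of \<open>lborel_I I\<close> applies.\<close>

lemma measurable_emeasure_slice:
  assumes "finite I" and [measurable]: "A \<in> sets (lborel_I (insert i I))"
  shows "(\<lambda>a. emeasure (lborel_I I) (slice I i A a)) \<in> borel_measurable borel"
proof -
  interpret sigma_finite_measure "lborel_I I"
    by (rule sigma_finite_lborel_I) fact
  note [measurable] = measurable_lborel_I_upd[of i I]
  have "{x \<in> space (borel \<Otimes>\<^sub>M lborel_I I). (\<lambda>(a, p). ((fst p)(i := a), snd p)) x \<in> A}
      \<in> sets (borel \<Otimes>\<^sub>M lborel_I I)" (is "?X \<in> _")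
    by measurable
  moreover have "Pair a -` ?X = slice I i A a" for a
    by (auto simp: space_pair_measure slice_def)
  ultimately show ?thesis
    using measurable_emeasure_Pair[of ?X] by simp
qed

lemma emeasure_lborel_I_insert:
  assumes I: "finite I" "i \<notin> I" and A [measurable]: "A \<in> sets (lborel_I (insert i I))"
  shows "emeasure (lborel_I (insert i I)) A = (\<integral>\<^sup>+a. emeasure (lborel_I I) (slice I i A a) \<partial>lborel)"
proof -
  have "emeasure (lborel_I (insert i I)) A =
      (\<integral>\<^sup>+a. \<integral>\<^sup>+p. indicator A ((fst p)(i := a), snd p) \<partial>lborel_I I \<partial>lborel)"
    using nn_integral_lborel_I_insert[OF I, of "indicator A"] A by simp
  also have "\<dots> = (\<integral>\<^sup>+a. \<integral>\<^sup>+p. indicator (slice I i A a) p \<partial>lborel_I I \<partial>lborel)"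
    by (intro nn_integral_cong) (auto simp: slice_def indicator_def)
  also have "\<dots> = (\<integral>\<^sup>+a. emeasure (lborel_I I) (slice I i A a) \<partial>lborel)"
    using A by (intro nn_integral_cong nn_integral_indicator sets_slice)
  finally show ?thesis .
qed

definition slice2 :: "nat set \<Rightarrow> nat \<Rightarrow> nat \<Rightarrow> ((nat \<Rightarrow> real) \<times> real) set \<Rightarrow>
    real \<times> real \<Rightarrow> ((nat \<Rightarrow> real) \<times> real) set" where
  "slice2 I i j A z = slice I j (slice (insert j I) i A (fst z)) (snd z)"

lemma mem_slice2_iff:
  "p \<in> slice2 I i j A z \<longleftrightarrow>
    p \<in> space (lborel_I I) \<and> ((fst p)(j := snd z, i := fst z), snd p) \<in> A"
  by (auto simp: slice2_def slice_def space_lborel_I PiE_iff extensional_def)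

lemma sets_slice2:
  "A \<in> sets (lborel_I (insert i (insert j I))) \<Longrightarrow> slice2 I i j A z \<in> sets (lborel_I I)"
  unfolding slice2_def by (intro sets_slice)

lemma measurable_emeasure_slice2:
  assumes "finite I" and [measurable]: "A \<in> sets (lborel_I (insert i (insert j I)))"
  shows "(\<lambda>z. emeasure (lborel_I I) (slice2 I i j A z)) \<in> borel_measurable lborel2"
proof -
  interpret sigma_finite_measure "lborel_I I"
    by (rule sigma_finite_lborel_I) fact
  have "(\<lambda>(z, p). (snd z, p)) \<in> lborel2 \<Otimes>\<^sub>M lborel_I I \<rightarrow>\<^sub>M borel \<Otimes>\<^sub>M lborel_I I"
    by measurable
  from measurable_compose[OF this measurable_lborel_I_upd[of j I]]
  have "(\<lambda>(z, p). (fst z, (fst p)(j := snd z), snd p)) \<in>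
      lborel2 \<Otimes>\<^sub>M lborel_I I \<rightarrow>\<^sub>M borel \<Otimes>\<^sub>M lborel_I (insert j I)"
    by (simp add: split_beta)
  from measurable_compose[OF this measurable_lborel_I_upd[of i "insert j I"]]
  have [measurable]: "(\<lambda>(z, p). ((fst p)(j := snd z, i := fst z), snd p)) \<in>
      lborel2 \<Otimes>\<^sub>M lborel_I I \<rightarrow>\<^sub>M lborel_I (insert i (insert j I))"
    by (simp add: split_beta)
  have "{x \<in> space (lborel2 \<Otimes>\<^sub>M lborel_I I). (\<lambda>(z, p). ((fst p)(j := snd z, i := fst z), snd p)) x \<in> A}
       \<in> sets (lborel2 \<Otimes>\<^sub>M lborel_I I)" (is "?X \<in> _")
    by measurable
  moreover have "Pair z -` ?X = slice2 I i j A z" for z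
    by (auto simp: space_pair_measure mem_slice2_iff)
  ultimately show ?thesis
    using measurable_emeasure_Pair[of ?X] by simp
qed

lemma emeasure_lborel_I_insert2:
  assumes I: "finite I" "i \<notin> I" "j \<notin> I" "i \<noteq> j" and A: "A \<in> sets (lborel_I (insert i (insert j I)))"
  shows "emeasure (lborel_I (insert i (insert j I))) A =
    (\<integral>\<^sup>+z. emeasure (lborel_I I) (slice2 I i j A z) \<partial>lborel2)"
proof -
  note [measurable] = measurable_emeasure_slice2[OF I(1) A]
  have "emeasure (lborel_I (insert i (insert j I))) A =
      (\<integral>\<^sup>+a. emeasure (lborel_I (insert j I)) (slice (insert j I) i A a) \<partial>lborel)"
    using I A by (intro emeasure_lborel_I_insert) auto
  also have "\<dots> = (\<integral>\<^sup>+a. \<integral>\<^sup>+b. emeasure (lborel_I I) (slice2 I i j A (a, b)) \<partial>lborel \<partial>lborel)"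
    using I A by (intro nn_integral_cong) (simp add: slice2_def emeasure_lborel_I_insert sets_slice)
  also have "\<dots> = (\<integral>\<^sup>+z. emeasure (lborel_I I) (slice2 I i j A z) \<partial>lborel2)"
    by (intro lborel.nn_integral_fst) measurable
  finally show ?thesis .
qed

subsection \<open>Vertical projections\<close>

text \<open>
  Induction is over the set \<open>J\<close> of those \<open>j \<le> n\<close> for which the coordinates \<open>j\<close> and \<open>n + j\<close> are kept.
  Deleted coordinates are set to \<open>undefined\<close> rather than renumbered.
\<close>

definition pairs :: "nat \<Rightarrow> nat set \<Rightarrow> nat set" where
  "pairs n J = J \<union> (+) n ` J"

lemma finite_pairs [simp]: "finite J \<Longrightarrow> finite (pairs n J)"
  by (simp add: pairs_def)

lemma pairs_insert: "pairs n (insert k J) = insert k (insert (n + k) (pairs n J))"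
  by (auto simp: pairs_def)

lemma pairs_disjoint:
  fixes J :: "nat set"
  assumes J: "J \<subseteq> {1..n}"
  shows "J \<inter> (+) n ` J = {}"
proof -
  have False if "y \<in> J" "n + y \<in> J" for y
    using subsetD[OF J that(1)] subsetD[OF J that(2)] by simp
  then show ?thesis by auto
qed

lemma prod_pairs:
  fixes g :: "nat \<Rightarrow> 'a::comm_monoid_mult"
  assumes "J \<subseteq> {1..n}"
  shows "prod g (pairs n J) = (\<Prod>j\<in>J. g j * g (n + j))"
proof -
  have "finite J"
    using assms finite_subset by blast
  then have "prod g (pairs n J) = prod g J * prod g ((+) n ` J)"
    unfolding pairs_def using pairs_disjoint[OF assms] by (intro prod.union_disjoint) auto
  also have "prod g ((+) n ` J) = (\<Prod>j\<in>J. g (n + j))"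
    by (subst prod.reindex) auto
  finally show ?thesis
    by (simp add: prod.distrib)
qed

lemma card_pairs:
  assumes "J \<subseteq> {1..n}"
  shows "card (pairs n J) = 2 * card J"
proof -
  have "finite J"
    using assms finite_subset by blast
  then show ?thesis
    unfolding pairs_def using pairs_disjoint[OF assms]
    by (subst card_Un_disjoint) (auto simp: card_image)
qed

lemma not_mem_pairs:
  assumes "insert k J \<subseteq> {1..n}" "k \<notin> J"
  shows "k \<notin> pairs n J" "n + k \<notin> pairs n J"
  using assms by (force simp: pairs_def)+

definition vproj_upd :: "nat \<Rightarrow> nat \<Rightarrow> (nat \<Rightarrow> real) \<times> real \<Rightarrow> (nat \<Rightarrow> real) \<times> real" where
  "vproj_upd n i p = ((fst p)(i := undefined),
     if i \<le> n then snd p + 1 / 2 * fst p i * fst p (n + i) else snd p - 1 / 2 * fst p (i - n) * fst p i)"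

text \<open>The product term involves the partner of \<open>i\<close>, which lies in
  \<open>pairs n J\<close> too. On the space, resetting coordinate \<open>i\<close> to
  \<open>undefined\<close> is a restriction, which makes the first component measurable.\<close>

lemma measurable_vproj_upd:
  assumes J: "J \<subseteq> {1..n}" and i: "i \<in> pairs n J"
  shows "vproj_upd n i \<in> lborel_I (pairs n J) \<rightarrow>\<^sub>M lborel_I (pairs n J - {i})"
proof -
  have restr: "(\<lambda>p. restrict (fst p) (pairs n J - {i})) \<in>
      lborel_I (pairs n J) \<rightarrow>\<^sub>M (\<Pi>\<^sub>M i\<in>pairs n J - {i}. lborel)"
    unfolding lborel_I_def by (rule measurable_compose[OF measurable_fst measurable_restrict_subset]) auto
  have eq: "restrict (fst p) (pairs n J - {i}) = (fst p)(i := undefined)"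
    if "p \<in> space (lborel_I (pairs n J))" for p
    using that by (auto simp: space_lborel_I PiE_iff extensional_def fun_eq_iff restrict_def)
  have fst: "(\<lambda>p. (fst p)(i := undefined)) \<in>
      lborel_I (pairs n J) \<rightarrow>\<^sub>M (\<Pi>\<^sub>M i\<in>pairs n J - {i}. lborel)"
    by (rule iffD1[OF measurable_cong[OF eq] restr])
  have comp: "(\<lambda>p. fst p j) \<in> borel_measurable (lborel_I (pairs n J))" if "j \<in> pairs n J" for j
    unfolding lborel_I_def
    by (rule measurable_compose[OF measurable_fst]) (use that in measurable)
  have snd: "snd \<in> borel_measurable (lborel_I (pairs n J))"
    unfolding lborel_I_def by measurable
  show ?thesis
  proof (cases "i \<le> n")
    case True
    then have "n + i \<in> pairs n J"
      using i J by (force simp: pairs_def)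
    then show ?thesis
      using True fst snd comp i unfolding vproj_upd_def
      by (subst (2) lborel_I_def) (auto intro!: measurable_Pair)
  next
    case False
    then have "i - n \<in> pairs n J"
      using i J by (auto simp: pairs_def)
    then show ?thesis
      using False fst snd comp i unfolding vproj_upd_def
      by (subst (2) lborel_I_def) (auto intro!: measurable_Pair)
  qed
qed

text \<open>The largest set whose projections lie in the \<open>A i\<close>. It is measurable when
  the \<open>A i\<close> are, whereas the projections of a measurable set may fail to be
  Borel.\<close>

definition vproj_inter :: "nat \<Rightarrow> nat set \<Rightarrow> (nat \<Rightarrow> ((nat \<Rightarrow> real) \<times> real) set) \<Rightarrow> ((nat \<Rightarrow> real) \<times> real) set" where
  "vproj_inter n J A = {p \<in> space (lborel_I (pairs n J)). \<forall>i\<in>pairs n J. vproj_upd n i p \<in> A i}"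

lemma sets_vproj_inter:
  assumes J: "J \<subseteq> {1..n}" and A: "\<And>i. i \<in> pairs n J \<Longrightarrow> A i \<in> sets (lborel_I (pairs n J - {i}))"
  shows "vproj_inter n J A \<in> sets (lborel_I (pairs n J))"
proof -
  have "{p \<in> space (lborel_I (pairs n J)). vproj_upd n i p \<in> A i} \<in> sets (lborel_I (pairs n J))"
    if "i \<in> pairs n J" for i
    using measurable_sets[OF measurable_vproj_upd[OF J that] A[OF that]]
    by (simp add: vimage_def Int_def conj_commute)
  then show ?thesis
    unfolding vproj_inter_def
    using finite_subset[OF J] by (intro sets.sets_Collect_finite_All) auto
qed

text \<open>The \<open>A i\<close> are arbitrary measurable sets rather than projections, because
  the induction step applies the hypothesis to slices of the \<open>A i\<close>. The constant is the
  same for all \<open>J\<close>.\<close>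

definition loomis_whitney :: "nat \<Rightarrow> nat set \<Rightarrow> bool" where
  "loomis_whitney n J \<longleftrightarrow> (\<forall>A. (\<forall>i\<in>pairs n J. A i \<in> sets (lborel_I (pairs n J - {i}))) \<longrightarrow>
     emeasure (lborel_I (pairs n J)) (vproj_inter n J A) \<le>
       3 * (\<Prod>i\<in>pairs n J. ennpowr (emeasure (lborel_I (pairs n J - {i})) (A i))
         ((real (card J) + 1) / (real (card J) * (2 * real (card J) + 1)))))"

text \<open>Write a, b for the coordinates k, n + k. After a translation in \<open>t\<close> the two
  conditions say that (a, t) is in \<open>Y\<close> and (b, t + a b) is in \<open>X\<close>, a point
  on the line with slope a and intercept t. Integrating over b first gives the incidence
  integral.\<close>

lemma loomis_whitney_singleton:
  assumes k: "k \<in> {1..n}"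
  shows "loomis_whitney n {k}"
  unfolding loomis_whitney_def
proof (intro allI impI)
  fix A assume A: "\<forall>i\<in>pairs n {k}. A i \<in> sets (lborel_I (pairs n {k} - {i}))"
  have P: "pairs n {k} = {k, n + k}" "pairs n {k} - {k} = {n + k}" "pairs n {k} - {n + k} = {k}"
    using k by (auto simp: pairs_def)
  have Ak: "A k \<in> sets (lborel_I {n + k})" and Ank: "A (n + k) \<in> sets (lborel_I {k})"
    using bspec[OF A, of k] bspec[OF A, of "n + k"] unfolding P(2,3) by (simp_all add: P(1))
  \<comment> \<open>With one index left the space is a plane; \<open>S\<close> transports sets
    there.\<close>
  define S where "S i C = {z. (((\<lambda>_. undefined)(i := fst z), snd z) :: (nat \<Rightarrow> real) \<times> real) \<in> C}"
    for i and C :: "((nat \<Rightarrow> real) \<times> real) set"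
  have S_meas [measurable]: "S i C \<in> sets lborel2" if "C \<in> sets (lborel_I {i})" for i C
  proof -
    have "(\<lambda>z. ((\<lambda>_. undefined)(i := fst z), snd z)) \<in> lborel2 \<rightarrow>\<^sub>M lborel_I {i}"
      unfolding lborel_I_def
      by (intro measurable_Pair measurable_fun_upd[where J = "{}"]) (auto simp: space_PiM)
    from measurable_sets[OF this that] show ?thesis
      by (simp add: S_def vimage_def space_pair_measure)
  qed
  have S_emeasure: "emeasure lborel2 (S i C) = emeasure (lborel_I {i}) C" if C: "C \<in> sets (lborel_I {i})" for i C
  proof -
    have "emeasure (lborel_I {i}) C = (\<integral>\<^sup>+a. emeasure (lborel_I {}) (slice {} i C a) \<partial>lborel)"
      using C by (intro emeasure_lborel_I_insert) auto
    also have "\<dots> = (\<integral>\<^sup>+a. \<integral>\<^sup>+p. indicator (slice {} i C a) p \<partial>lborel_I {} \<partial>lborel)"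
      using C by (intro nn_integral_cong nn_integral_indicator[symmetric] sets_slice)
    also have "\<dots> = (\<integral>\<^sup>+a. \<integral>\<^sup>+t. indicator (slice {} i C a) (\<lambda>_. undefined, t) \<partial>lborel \<partial>lborel)"
      using C by (intro nn_integral_cong nn_integral_lborel_I_empty borel_measurable_indicator sets_slice)
    also have "\<dots> = (\<integral>\<^sup>+a. \<integral>\<^sup>+t. indicator (S i C) (a, t) \<partial>lborel \<partial>lborel)"
      by (intro nn_integral_cong) (auto simp: slice_def S_def indicator_def space_lborel_I)
    also have "\<dots> = emeasure lborel2 (S i C)"
      using S_meas[OF C]
      by (subst lborel.nn_integral_fst) (auto simp: nn_integral_indicator)
    finally show ?thesis ..
  qed
  define X where "X = S (n + k) (A k)"
  define Y where "Y = S k (A (n + k))"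
  have X [measurable]: "X \<in> sets lborel2" and Y [measurable]: "Y \<in> sets lborel2"
    unfolding X_def Y_def by (rule S_meas, fact)+
  have K: "vproj_inter n {k} A \<in> sets (lborel_I {k, n + k})"
  proof -
    have "vproj_inter n {k} A \<in> sets (lborel_I (pairs n {k}))"
      using A k by (intro sets_vproj_inter) auto
    then show ?thesis
      by (simp only: P(1))
  qed
  have "emeasure (lborel_I {k, n + k}) (vproj_inter n {k} A) =
      (\<integral>\<^sup>+z. emeasure (lborel_I {}) (slice2 {} k (n + k) (vproj_inter n {k} A) z) \<partial>lborel2)"
    using k by (intro emeasure_lborel_I_insert2 K) auto
  also have "\<dots> = (\<integral>\<^sup>+z. \<integral>\<^sup>+p. indicator (slice2 {} k (n + k) (vproj_inter n {k} A) z) p \<partial>lborel_I {} \<partial>lborel2)"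
    using K by (intro nn_integral_cong nn_integral_indicator[symmetric] sets_slice2)
  also have "\<dots> = (\<integral>\<^sup>+z. \<integral>\<^sup>+t. indicator (slice2 {} k (n + k) (vproj_inter n {k} A) z)
      (\<lambda>_. undefined, t) \<partial>lborel \<partial>lborel2)"
    using K by (intro nn_integral_cong nn_integral_lborel_I_empty borel_measurable_indicator sets_slice2)
  also have "\<dots> = (\<integral>\<^sup>+z. \<integral>\<^sup>+t. indicator X (snd z, t + fst z * snd z / 2) *
      indicator Y (fst z, t - fst z * snd z / 2) \<partial>lborel \<partial>lborel2)"
  proof (intro nn_integral_cong)
    fix z :: "real \<times> real" and t :: real
    let ?q = "((\<lambda>_. undefined)(n + k := snd z, k := fst z), t)"
    have "vproj_upd n k ?q = ((\<lambda>_. undefined)(n + k := snd z), t + fst z * snd z / 2)"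
      "vproj_upd n (n + k) ?q = ((\<lambda>_. undefined)(k := fst z), t - fst z * snd z / 2)"
      "?q \<in> space (lborel_I {k, n + k})"
      using k by (auto simp: vproj_upd_def fun_eq_iff space_lborel_I PiE_iff extensional_def)
    then have "(\<lambda>_. undefined, t) \<in> slice2 {} k (n + k) (vproj_inter n {k} A) z \<longleftrightarrow>
        (snd z, t + fst z * snd z / 2) \<in> X \<and> (fst z, t - fst z * snd z / 2) \<in> Y"
      by (simp add: mem_slice2_iff vproj_inter_def P(1) X_def Y_def S_def) (simp add: space_lborel_I)
    then show "indicator (slice2 {} k (n + k) (vproj_inter n {k} A) z) (\<lambda>_. undefined, t) =
        (indicator X (snd z, t + fst z * snd z / 2) * indicator Y (fst z, t - fst z * snd z / 2) :: ennreal)"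
      by (auto simp: indicator_def)
  qed
  \<comment> \<open>Substituting t + a b / 2 for \<open>t\<close> moves the whole product term into
    the factor of \<open>X\<close>.\<close>
  also have "\<dots> = (\<integral>\<^sup>+z. \<integral>\<^sup>+t. indicator X (snd z, t + fst z * snd z) * indicator Y (fst z, t) \<partial>lborel \<partial>lborel2)"
  proof (rule nn_integral_cong)
    fix z :: "real \<times> real"
    show "(\<integral>\<^sup>+t. indicator X (snd z, t + fst z * snd z / 2) * indicator Y (fst z, t - fst z * snd z / 2) \<partial>lborel) =
      (\<integral>\<^sup>+t. indicator X (snd z, t + fst z * snd z) * indicator Y (fst z, t) \<partial>lborel :: ennreal)"
      by (subst nn_integral_lborel_shift[of _ "fst z * snd z / 2", symmetric]) (auto simp: add.commute)
  qed
  also have "\<dots> = (\<integral>\<^sup>+a. \<integral>\<^sup>+b. \<integral>\<^sup>+t. indicator X (b, t + a * b) * indicator Y (a, t) \<partial>lborel \<partial>lborel \<partial>lborel)"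
    by (subst lborel.nn_integral_fst[symmetric]) auto
  also have "\<dots> = (\<integral>\<^sup>+a. \<integral>\<^sup>+t. \<integral>\<^sup>+b. indicator X (b, t + a * b) * indicator Y (a, t) \<partial>lborel \<partial>lborel \<partial>lborel)"
    by (intro nn_integral_cong lborel_pair.Fubini') measurable
  also have "\<dots> = (\<integral>\<^sup>+a. \<integral>\<^sup>+t. indicator Y (a, t) * line_integral X (a, t) \<partial>lborel \<partial>lborel)"
    by (simp add: line_integral_def nn_integral_cmult mult.commute)
  also have "\<dots> = (\<integral>\<^sup>+z. indicator Y z * line_integral X z \<partial>lborel2)"
    by (intro lborel.nn_integral_fst) measurable
  also have "\<dots> \<le> 3 * (ennpowr (emeasure lborel2 X) (2/3) * ennpowr (emeasure lborel2 Y) (2/3))"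
    by (rule nn_integral_incidences) measurable
  finally have "emeasure (lborel_I {k, n + k}) (vproj_inter n {k} A) \<le>
      3 * (ennpowr (emeasure lborel2 X) (2/3) * ennpowr (emeasure lborel2 Y) (2/3))" .
  moreover have "(\<Prod>i\<in>pairs n {k}. ennpowr (emeasure (lborel_I (pairs n {k} - {i})) (A i))
         ((real (card {k}) + 1) / (real (card {k}) * (2 * real (card {k}) + 1)))) =
      ennpowr (emeasure lborel2 X) (2/3) * ennpowr (emeasure lborel2 Y) (2/3)"
    using k Ak Ank by (subst prod_pairs) (simp_all add: P(2,3) X_def Y_def S_emeasure)
  ultimately show "emeasure (lborel_I (pairs n {k})) (vproj_inter n {k} A) \<le>
       3 * (\<Prod>i\<in>pairs n {k}. ennpowr (emeasure (lborel_I (pairs n {k} - {i})) (A i))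
         ((real (card {k}) + 1) / (real (card {k}) * (2 * real (card {k}) + 1))))"
    by (simp only: P)
qed

section \<open>Induction step: slicing along the pair \<open>k\<close>, \<open>n + k\<close> and
  averaging over \<open>k\<close>\<close>

lemma mem_vproj_inter_iff:
  "p \<in> vproj_inter n J A \<longleftrightarrow>
    p \<in> space (lborel_I (pairs n J)) \<and> (\<forall>i\<in>pairs n J. vproj_upd n i p \<in> A i)"
  by (simp add: vproj_inter_def)

context
  fixes n k J A I
  assumes J: "insert k J \<subseteq> {1..n}" "k \<notin> J"
    and A: "\<And>i. i \<in> pairs n (insert k J) \<Longrightarrow> A i \<in> sets (lborel_I (pairs n (insert k J) - {i}))"
  defines "I \<equiv> pairs n J"
begin

lemma pairs_insert_eq: "pairs n (insert k J) = insert k (insert (n + k) I)"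
  by (simp add: pairs_insert I_def)

lemma index_facts: "k \<notin> I" "n + k \<notin> I" "k \<noteq> n + k" "1 \<le> k" "k \<le> n" "finite I" "finite J"
  using not_mem_pairs[OF J] J finite_subset[OF J(1)] by (auto simp: I_def)

lemma pairs_insert_Diff:
  "pairs n (insert k J) - {k} = insert (n + k) I"
  "pairs n (insert k J) - {n + k} = insert k I"
  "i \<in> I \<Longrightarrow> pairs n (insert k J) - {i} = insert k (insert (n + k) (I - {i}))"
  using index_facts by (auto simp: pairs_insert_eq)

lemma sets_A:
  "A k \<in> sets (lborel_I (insert (n + k) I))"
  "A (n + k) \<in> sets (lborel_I (insert k I))"
  "i \<in> I \<Longrightarrow> A i \<in> sets (lborel_I (insert k (insert (n + k) (I - {i}))))"
  using A[of k] A[of "n + k"] A[of i] unfolding pairs_insert_Diff(1,2)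
  by (simp_all add: pairs_insert_eq pairs_insert_Diff(3)[unfolded pairs_insert_eq])

text \<open>For \<open>i\<close> in \<open>I\<close> neither \<open>i\<close> nor its partner is
  \<open>k\<close> or \<open>n + k\<close>, so the projection along \<open>i\<close> commutes with
  freezing those two coordinates.\<close>

lemma vproj_inter_slice2_subset:
  "slice2 I k (n + k) (vproj_inter n (insert k J) A) z \<subseteq>
    vproj_inter n J (\<lambda>i. slice2 (I - {i}) k (n + k) (A i) z)"
proof
  fix p assume p: "p \<in> slice2 I k (n + k) (vproj_inter n (insert k J) A) z"
  define q where "q = ((fst p)(n + k := snd z, k := fst z), snd p)"
  have pI: "p \<in> space (lborel_I I)" and q: "q \<in> vproj_inter n (insert k J) A"
    using p by (auto simp: mem_slice2_iff q_def)
  have "vproj_upd n i p \<in> slice2 (I - {i}) k (n + k) (A i) z" if i: "i \<in> I" for i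
  proof -
    have ne: "i \<noteq> k" "i \<noteq> n + k" "i \<le> n \<Longrightarrow> n + i \<noteq> k" "i \<le> n \<Longrightarrow> n + i \<noteq> n + k"
      "\<not> i \<le> n \<Longrightarrow> i - n \<noteq> k" "\<not> i \<le> n \<Longrightarrow> i - n \<noteq> n + k"
      using index_facts i J by (auto simp: I_def pairs_def)
    have "vproj_upd n i q \<in> A i"
      using q i by (simp add: mem_vproj_inter_iff pairs_insert_eq)
    also have "vproj_upd n i q =
        ((fst (vproj_upd n i p))(n + k := snd z, k := fst z), snd (vproj_upd n i p))"
      using ne by (auto simp: vproj_upd_def q_def fun_eq_iff)
    finally show ?thesis
      using pI by (auto simp: mem_slice2_iff vproj_upd_def space_lborel_I PiE_iff extensional_def)
  qed
  then show "p \<in> vproj_inter n J (\<lambda>i. slice2 (I - {i}) k (n + k) (A i) z)"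
    using pI by (simp add: mem_vproj_inter_iff I_def)
qed

text \<open>The product of the two frozen coordinates is constant on the slice, so the projection
  along \<open>k\<close> translates it by \<open>c\<close> into a slice of \<open>A k\<close>, and
  the one along \<open>n + k\<close> by \<open>- c\<close> into a slice of \<open>A (n + k)\<close>.
  The two bounds depend on different components of \<open>z\<close>.\<close>

lemma emeasure_vproj_inter_slice2_le:
  "emeasure (lborel_I I) (slice2 I k (n + k) (vproj_inter n (insert k J) A) z) \<le>
    emeasure (lborel_I I) (slice I (n + k) (A k) (snd z))" (is ?th1)
  "emeasure (lborel_I I) (slice2 I k (n + k) (vproj_inter n (insert k J) A) z) \<le>
    emeasure (lborel_I I) (slice I k (A (n + k)) (fst z))" (is ?th2)
proof -
  define K where "K = slice2 I k (n + k) (vproj_inter n (insert k J) A) z"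
  define c where "c = fst z * snd z / 2"
  have *: "p \<in> space (lborel_I I)" "(fst p, snd p + c) \<in> slice I (n + k) (A k) (snd z)"
      "(fst p, snd p + (- c)) \<in> slice I k (A (n + k)) (fst z)" if "p \<in> K" for p
  proof -
    define q where "q = ((fst p)(n + k := snd z, k := fst z), snd p)"
    have pI: "p \<in> space (lborel_I I)" and q: "q \<in> vproj_inter n (insert k J) A"
      using that by (auto simp: K_def mem_slice2_iff q_def)
    \<comment> \<open>Both coordinates are outside \<open>I\<close>, so deleting one of them in
      \<open>q\<close> restores its value in \<open>p\<close>.\<close>
    have undef: "fst p k = undefined" "fst p (n + k) = undefined"
      using pI index_facts by (auto simp: space_lborel_I PiE_iff extensional_def)
    have "vproj_upd n k q = ((fst p)(n + k := snd z), snd p + c)"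
      "vproj_upd n (n + k) q = ((fst p)(k := fst z), snd p + (- c))"
      using undef index_facts by (auto simp: vproj_upd_def q_def fun_eq_iff c_def)
    moreover have "vproj_upd n k q \<in> A k" "vproj_upd n (n + k) q \<in> A (n + k)"
      using q by (auto simp: mem_vproj_inter_iff pairs_insert_eq)
    ultimately show "p \<in> space (lborel_I I)" "(fst p, snd p + c) \<in> slice I (n + k) (A k) (snd z)"
      "(fst p, snd p + (- c)) \<in> slice I k (A (n + k)) (fst z)"
      using pI by (auto simp: slice_def space_lborel_I)
  qed
  have bound: "emeasure (lborel_I I) K \<le> emeasure (lborel_I I) E"
    if "E \<in> sets (lborel_I I)" "\<And>p. p \<in> K \<Longrightarrow> (fst p, snd p + d) \<in> E" for E d
  proof -
    have [measurable]: "(\<lambda>p. (fst p, snd p + d)) \<in> lborel_I I \<rightarrow>\<^sub>M lborel_I I"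
      unfolding lborel_I_def by measurable
    note [measurable] = that(1)
    have "emeasure (lborel_I I) K \<le> emeasure (lborel_I I) {p \<in> space (lborel_I I). (fst p, snd p + d) \<in> E}"
      using *(1) that(2) by (intro emeasure_mono) auto
    then show ?thesis
      by (simp only: emeasure_lborel_I_shift[OF that(1)])
  qed
  show ?th1
    unfolding K_def[symmetric] by (rule bound[OF sets_slice[OF sets_A(1)] *(2)])
  show ?th2
    unfolding K_def[symmetric] by (rule bound[OF sets_slice[OF sets_A(2)] *(3)])
qed

text \<open>On each slice the induction hypothesis is interpolated with the two slice bounds, with
  weights \<open>\<theta>\<close>, \<open>\<phi>\<close>, \<open>\<phi>\<close>, which add up to 1
  by \<open>sum1\<close>. The weight condition of Hoelder's inequality in \<open>z\<close> is
  \<open>sum2\<close>, where \<open>\<phi>\<close> counts only once.\<close>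

lemma loomis_whitney_weighted:
  fixes s \<theta> \<phi> :: real
  assumes IH: "\<And>B. (\<And>i. i \<in> I \<Longrightarrow> B i \<in> sets (lborel_I (I - {i}))) \<Longrightarrow>
      emeasure (lborel_I I) (vproj_inter n J B) \<le> 3 * (\<Prod>i\<in>I. ennpowr (emeasure (lborel_I (I - {i})) (B i)) s)"
    and pos: "\<theta> > 0" "\<phi> > 0" "s > 0" and sum1: "\<theta> + 2 * \<phi> = 1" and sum2: "card I * (\<theta> * s) + \<phi> = 1"
  shows "emeasure (lborel_I (pairs n (insert k J))) (vproj_inter n (insert k J) A) \<le>
    3 * (ennpowr (emeasure (lborel_I (pairs n (insert k J) - {k})) (A k)) \<phi> *
      ennpowr (emeasure (lborel_I (pairs n (insert k J) - {n + k})) (A (n + k))) \<phi> *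
      (\<Prod>i\<in>I. ennpowr (emeasure (lborel_I (pairs n (insert k J) - {i})) (A i)) (\<theta> * s)))"
proof -
  let ?M = "lborel_I I"
  define K where "K z = slice2 I k (n + k) (vproj_inter n (insert k J) A) z" for z
  define S where "S i z = emeasure (lborel_I (I - {i})) (slice2 (I - {i}) k (n + k) (A i) z)" for i z
  \<comment> \<open>Both slice bounds enter as one Hoelder factor with a single weight: they depend
    on separate components of \<open>z\<close>, so the integral of \<open>T\<close> is the product
    of their integrals.\<close>
  define T where "T z = emeasure ?M (slice I (n + k) (A k) (snd z)) * emeasure ?M (slice I k (A (n + k)) (fst z))"
    for z
  \<comment> \<open>As \<open>k\<close> is not in \<open>I\<close>, it can serve as the index of
    \<open>T\<close>.\<close>
  define f where "f i = (if i = k then T else S i)" for i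
  define p where "p i = (if i = k then \<phi> else \<theta> * s)" for i
  have S_meas: "S i \<in> borel_measurable lborel2" if "i \<in> I" for i
    unfolding S_def using index_facts sets_A(3)[OF that] by (intro measurable_emeasure_slice2) auto
  have [measurable]:
    "(\<lambda>a. emeasure ?M (slice I (n + k) (A k) a)) \<in> borel_measurable borel"
    "(\<lambda>a. emeasure ?M (slice I k (A (n + k)) a)) \<in> borel_measurable borel"
    using index_facts sets_A by (auto intro!: measurable_emeasure_slice)
  have T_meas [measurable]: "T \<in> borel_measurable lborel2"
    unfolding T_def by measurable
  have S_int: "(\<integral>\<^sup>+z. S i z \<partial>lborel2) = emeasure (lborel_I (pairs n (insert k J) - {i})) (A i)" if "i \<in> I" for i
    unfolding S_def pairs_insert_Diff(3)[OF that]
    using index_facts sets_A(3)[OF that] by (intro emeasure_lborel_I_insert2[symmetric]) auto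
  have T_int: "(\<integral>\<^sup>+z. T z \<partial>lborel2) = emeasure (lborel_I (pairs n (insert k J) - {k})) (A k) *
      emeasure (lborel_I (pairs n (insert k J) - {n + k})) (A (n + k))"
    unfolding pairs_insert_Diff(1,2)
    using index_facts sets_A
    by (subst lborel.nn_integral_fst[symmetric])
       (auto simp: T_def nn_integral_cmult nn_integral_multc emeasure_lborel_I_insert)
  have K_le: "emeasure ?M (K z) \<le> 3 * (\<Prod>i\<in>insert k I. ennpowr (f i z) (p i))" for z
  proof -
    let ?m = "emeasure ?M (K z)"
    have B: "slice2 (I - {i}) k (n + k) (A i) z \<in> sets (lborel_I (I - {i}))" if "i \<in> I" for i
      using sets_A(3)[OF that] by (rule sets_slice2)
    have "vproj_inter n J (\<lambda>i. slice2 (I - {i}) k (n + k) (A i) z) \<in> sets ?M"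
      using sets_vproj_inter[of J n "\<lambda>i. slice2 (I - {i}) k (n + k) (A i) z"] J B by (simp add: I_def)
    then have "?m \<le> emeasure ?M (vproj_inter n J (\<lambda>i. slice2 (I - {i}) k (n + k) (A i) z))"
      unfolding K_def by (intro emeasure_mono vproj_inter_slice2_subset)
    also have "\<dots> \<le> 3 * (\<Prod>i\<in>I. ennpowr (S i z) s)"
      unfolding S_def by (intro IH B)
    finally have m1: "?m \<le> 3 * (\<Prod>i\<in>I. ennpowr (S i z) s)" .
    have "?m = ennpowr ?m \<theta> * (ennpowr ?m \<phi> * ennpowr ?m \<phi>)"
    proof -
      have "\<theta> + (\<phi> + \<phi>) = 1"
        using sum1 by simp
      then show ?thesis
        by (metis ennpowr_1 ennpowr_add)
    qed
    also have "\<dots> \<le> ennpowr (3 * (\<Prod>i\<in>I. ennpowr (S i z) s)) \<theta> * ennpowr (T z) \<phi>"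
      unfolding T_def ennpowr_mult[of _ _ \<phi>] using pos
      by (intro mult_mono ennpowr_mono m1 emeasure_vproj_inter_slice2_le[folded K_def]) auto
    also have "ennpowr (3 * (\<Prod>i\<in>I. ennpowr (S i z) s)) \<theta> = ennpowr 3 \<theta> * (\<Prod>i\<in>I. ennpowr (S i z) (\<theta> * s))"
      by (simp add: ennpowr_mult ennpowr_prod ennpowr_ennpowr mult.commute)
    \<comment> \<open>Since \<open>\<theta>\<close> is at most 1, the constant does not grow beyond
      3.\<close>
    also have "ennpowr 3 \<theta> * (\<Prod>i\<in>I. ennpowr (S i z) (\<theta> * s)) * ennpowr (T z) \<phi> \<le>
        3 * (\<Prod>i\<in>I. ennpowr (S i z) (\<theta> * s)) * ennpowr (T z) \<phi>"
      using sum1 pos by (intro mult_right_mono ennpowr_le_self) auto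
    also have "(\<Prod>i\<in>I. ennpowr (S i z) (\<theta> * s)) = (\<Prod>i\<in>I. ennpowr (f i z) (p i))"
      using index_facts by (intro prod.cong) (auto simp: f_def p_def)
    also have "3 * (\<Prod>i\<in>I. ennpowr (f i z) (p i)) * ennpowr (T z) \<phi> =
        3 * (\<Prod>i\<in>insert k I. ennpowr (f i z) (p i))"
      using index_facts by (simp add: f_def p_def mult_ac)
    finally show ?thesis .
  qed
  have K_meas: "vproj_inter n (insert k J) A \<in> sets (lborel_I (pairs n (insert k J)))"
    using J A by (intro sets_vproj_inter) auto
  have "emeasure (lborel_I (pairs n (insert k J))) (vproj_inter n (insert k J) A) =
      (\<integral>\<^sup>+z. emeasure ?M (K z) \<partial>lborel2)"
    using K_meas index_facts unfolding K_def pairs_insert_eq by (intro emeasure_lborel_I_insert2) auto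
  also have "\<dots> \<le> (\<integral>\<^sup>+z. 3 * (\<Prod>i\<in>insert k I. ennpowr (f i z) (p i)) \<partial>lborel2)"
    by (intro nn_integral_mono K_le)
  also have "\<dots> = 3 * (\<integral>\<^sup>+z. (\<Prod>i\<in>insert k I. ennpowr (f i z) (p i)) \<partial>lborel2)"
    using S_meas T_meas
    by (intro nn_integral_cmult borel_measurable_prod_ennreal measurable_ennpowr) (auto simp: f_def)
  also have "(\<integral>\<^sup>+z. (\<Prod>i\<in>insert k I. ennpowr (f i z) (p i)) \<partial>lborel2) \<le>
      (\<Prod>i\<in>insert k I. ennpowr (\<integral>\<^sup>+z. f i z \<partial>lborel2) (p i))"
  proof (rule nn_integral_Holder_prod)
    have "sum p I = (\<Sum>i\<in>I. \<theta> * s)"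
      using index_facts by (intro sum.cong) (auto simp: p_def)
    then show "sum p (insert k I) = 1"
      using index_facts sum2 by (simp add: p_def)
  qed (use index_facts S_meas T_meas pos in \<open>auto simp: f_def p_def\<close>)
  also have "(\<Prod>i\<in>insert k I. ennpowr (\<integral>\<^sup>+z. f i z \<partial>lborel2) (p i)) =
      ennpowr (\<integral>\<^sup>+z. T z \<partial>lborel2) \<phi> * (\<Prod>i\<in>I. ennpowr (\<integral>\<^sup>+z. f i z \<partial>lborel2) (p i))"
    using index_facts by (simp add: f_def p_def)
  also have "(\<Prod>i\<in>I. ennpowr (\<integral>\<^sup>+z. f i z \<partial>lborel2) (p i)) =
      (\<Prod>i\<in>I. ennpowr (emeasure (lborel_I (pairs n (insert k J) - {i})) (A i)) (\<theta> * s))"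
    using index_facts by (intro prod.cong) (auto simp: f_def p_def S_int)
  finally show ?thesis
    by (simp add: T_int ennpowr_mult mult_left_mono)
qed

end

text \<open>Here \<open>m\<close> is the number of pairs in the induction hypothesis and
  \<open>s\<close> its exponent; for this \<open>s\<close> the first two equations determine
  \<open>\<theta>\<close> and \<open>\<phi>\<close>. The third gives the exponent after averaging
  over the \<open>m + 1\<close> choices of \<open>k\<close>: each pair receives
  \<open>\<phi>\<close> once and \<open>\<theta> * s\<close> the other \<open>m\<close>
  times.\<close>

lemma loomis_whitney_insert_exponents:
  fixes m :: nat
  assumes "m \<ge> 1"
  defines "s \<equiv> (real m + 1) / (real m * (2 * real m + 1))"
    and "\<theta> \<equiv> (2 * real m + 1) / (2 * real m + 3)" and "\<phi> \<equiv> 1 / (2 * real m + 3)"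
  shows "\<theta> + 2 * \<phi> = 1" and "2 * real m * (\<theta> * s) + \<phi> = 1"
    and "(\<phi> + real m * (\<theta> * s)) / real (Suc m) = (real (Suc m) + 1) / (real (Suc m) * (2 * real (Suc m) + 1))"
proof -
  have \<theta>s: "real m * (\<theta> * s) = (real m + 1) / (2 * real m + 3)"
  proof -
    have "2 * real m + 1 \<noteq> 0"
      by linarith
    with assms(1) have "real m * s * (2 * real m + 1) = real m + 1"
      by (simp add: s_def)
    then show ?thesis
      by (simp add: \<theta>_def mult_ac)
  qed
  have d: "2 * real m + 3 \<noteq> 0"
    by linarith
  then show "\<theta> + 2 * \<phi> = 1"
    by (simp add: \<theta>_def \<phi>_def divide_simps)
  show "2 * real m * (\<theta> * s) + \<phi> = 1"
    unfolding mult.assoc \<theta>s using d by (simp add: \<phi>_def divide_simps)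
  have "\<phi> + real m * (\<theta> * s) = (real (Suc m) + 1) / (2 * real (Suc m) + 1)"
    unfolding \<theta>s \<phi>_def by (simp add: add_ac flip: add_divide_distrib)
  then show "(\<phi> + real m * (\<theta> * s)) / real (Suc m) =
      (real (Suc m) + 1) / (real (Suc m) * (2 * real (Suc m) + 1))"
    by (simp only: divide_divide_eq_left mult.commute)
qed

text \<open>Each \<open>k\<close> in \<open>J\<close> yields an inequality in which its own pair has
  a special exponent; the geometric mean over \<open>k\<close> equalises the exponents.\<close>

lemma loomis_whitney_step:
  assumes J: "J \<subseteq> {1..n}" and card: "card J = Suc m" "m \<ge> 1"
    and IH: "\<And>k. k \<in> J \<Longrightarrow> loomis_whitney n (J - {k})"
  shows "loomis_whitney n J"
  unfolding loomis_whitney_def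
proof (intro allI impI)
  fix A assume A: "\<forall>i\<in>pairs n J. A i \<in> sets (lborel_I (pairs n J - {i}))"
  define s where "s = (real m + 1) / (real m * (2 * real m + 1))"
  define \<theta> where "\<theta> = (2 * real m + 1) / (2 * real m + 3)"
  define \<phi> where "\<phi> = 1 / (2 * real m + 3)"
  note exps = loomis_whitney_insert_exponents[OF card(2), folded s_def \<theta>_def \<phi>_def]
  have pos: "\<theta> > 0" "\<phi> > 0" "s > 0"
    using card(2) by (auto simp: s_def \<theta>_def \<phi>_def)
  define K where "K = emeasure (lborel_I (pairs n J)) (vproj_inter n J A)"
  define a where "a i = emeasure (lborel_I (pairs n J - {i})) (A i)" for i
  \<comment> \<open>Both members of a pair always carry the same exponent, so they are
    merged.\<close>
  define b where "b j = a j * a (n + j)" for j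
  define r where "r = 1 / real (Suc m)"
  \<comment> \<open>The exponent of the pair \<open>j\<close> in the inequality obtained from
    \<open>k\<close>.\<close>
  define e where "e k j = (if j = k then \<phi> else \<theta> * s)" for k j :: nat
  have finJ: "finite J" and "J \<noteq> {}"
    using finite_subset[OF J] card by auto
  have step: "K \<le> 3 * (\<Prod>j\<in>J. ennpowr (b j) (e k j))" if k: "k \<in> J" for k
  proof -
    have ins: "insert k (J - {k}) = J" and cardk: "card (J - {k}) = m" and Jk: "J - {k} \<subseteq> {1..n}"
      using k card finJ J by auto
    have "K \<le> 3 * (ennpowr (a k) \<phi> * ennpowr (a (n + k)) \<phi> *
        (\<Prod>i\<in>pairs n (J - {k}). ennpowr (a i) (\<theta> * s)))"
      unfolding K_def a_def
    proof (rule loomis_whitney_weighted[of k "J - {k}", unfolded ins])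
      show "J \<subseteq> {1..n}" "k \<notin> J - {k}" "\<theta> > 0" "\<phi> > 0" "s > 0" "\<theta> + 2 * \<phi> = 1"
        using J pos exps by auto
      show "A i \<in> sets (lborel_I (pairs n J - {i}))" if "i \<in> pairs n J" for i
        using A that by auto
      show "real (card (pairs n (J - {k}))) * (\<theta> * s) + \<phi> = 1"
        using exps(2) by (simp add: card_pairs[OF Jk] cardk)
      show "emeasure (lborel_I (pairs n (J - {k}))) (vproj_inter n (J - {k}) B) \<le>
          3 * (\<Prod>i\<in>pairs n (J - {k}). ennpowr (emeasure (lborel_I (pairs n (J - {k}) - {i})) (B i)) s)"
        if "\<And>i. i \<in> pairs n (J - {k}) \<Longrightarrow> B i \<in> sets (lborel_I (pairs n (J - {k}) - {i}))" for B
        using IH[OF k] that unfolding loomis_whitney_def cardk s_def by blast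
    qed
    also have "ennpowr (a k) \<phi> * ennpowr (a (n + k)) \<phi> * (\<Prod>i\<in>pairs n (J - {k}). ennpowr (a i) (\<theta> * s)) =
        ennpowr (b k) \<phi> * (\<Prod>j\<in>J - {k}. ennpowr (b j) (\<theta> * s))"
      unfolding prod_pairs[OF Jk] b_def ennpowr_mult ..
    also have "\<dots> = (\<Prod>j\<in>J. ennpowr (b j) (e k j))"
      using finJ k by (subst prod.remove[OF finJ k]) (auto simp: e_def intro!: prod.cong)
    finally show ?thesis .
  qed
  have sum_e: "(\<Sum>k\<in>J. e k j * r) = (real (Suc m) + 1) / (real (Suc m) * (2 * real (Suc m) + 1))" if "j \<in> J" for j
  proof -
    have "(\<Sum>k\<in>J. e k j) = \<phi> + (\<Sum>k\<in>J - {j}. \<theta> * s)"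
      using that by (subst sum.remove[OF finJ that]) (auto simp: e_def intro!: sum.cong)
    also have "\<dots> = \<phi> + real m * (\<theta> * s)"
      using that card finJ by simp
    finally show ?thesis
      using exps(3) by (simp add: r_def flip: sum_divide_distrib)
  qed
  have sum_r: "(\<Sum>k\<in>J. r) = 1"
    using card by (simp add: r_def)
  have "K = (\<Prod>k\<in>J. ennpowr K r)"
    using ennpowr_sum[OF finJ \<open>J \<noteq> {}\<close>, of K "\<lambda>_. r"] unfolding sum_r by simp
  also have "\<dots> \<le> (\<Prod>k\<in>J. ennpowr (3 * (\<Prod>j\<in>J. ennpowr (b j) (e k j))) r)"
    using step by (intro prod_mono_ennreal ennpowr_mono) (auto simp: r_def)
  also have "\<dots> = (\<Prod>k\<in>J. ennpowr 3 r) * (\<Prod>k\<in>J. \<Prod>j\<in>J. ennpowr (b j) (e k j * r))"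
    by (simp add: ennpowr_mult ennpowr_prod ennpowr_ennpowr prod.distrib del: prod_constant)
  \<comment> \<open>The exponents \<open>r\<close> add up to 1, so the mean preserves the constant
    3.\<close>
  also have "(\<Prod>k\<in>J. ennpowr 3 r) = 3"
    using ennpowr_sum[OF finJ \<open>J \<noteq> {}\<close>, of 3 "\<lambda>_. r"] unfolding sum_r by simp
  also have "(\<Prod>k\<in>J. \<Prod>j\<in>J. ennpowr (b j) (e k j * r)) = (\<Prod>j\<in>J. \<Prod>k\<in>J. ennpowr (b j) (e k j * r))"
    by (rule prod.swap)
  also have "\<dots> = (\<Prod>j\<in>J. ennpowr (b j) ((real (Suc m) + 1) / (real (Suc m) * (2 * real (Suc m) + 1))))"
    using sum_e by (intro prod.cong refl) (simp flip: ennpowr_sum[OF finJ \<open>J \<noteq> {}\<close>] del: of_nat_Suc)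
  also have "\<dots> = (\<Prod>i\<in>pairs n J. ennpowr (a i) ((real (Suc m) + 1) / (real (Suc m) * (2 * real (Suc m) + 1))))"
    by (simp add: prod_pairs[OF J] b_def ennpowr_mult del: of_nat_Suc)
  finally show "emeasure (lborel_I (pairs n J)) (vproj_inter n J A) \<le>
       3 * (\<Prod>i\<in>pairs n J. ennpowr (emeasure (lborel_I (pairs n J - {i})) (A i))
         ((real (card J) + 1) / (real (card J) * (2 * real (card J) + 1))))"
    unfolding card(1) K_def a_def .
qed

lemma loomis_whitney_all: "J \<subseteq> {1..n} \<Longrightarrow> J \<noteq> {} \<Longrightarrow> loomis_whitney n J"
proof (induction "card J" arbitrary: J)
  case 0
  then show ?case
    using finite_subset[of J "{1..n}"] by auto
next
  case (Suc m)
  show ?case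
  \<comment> \<open>The induction really starts at one pair: removing it would leave the excluded
    empty set.\<close>
  proof (cases "m = 0")
    case True
    then have "card J = 1"
      using Suc.hyps(2) by simp
    then obtain k where "J = {k}"
      by (rule card_1_singletonE)
    then show ?thesis
      using Suc.prems by (auto intro: loomis_whitney_singleton)
  next
    case False
    have "loomis_whitney n (J - {k})" if "k \<in> J" for k
    proof (rule Suc.hyps(1))
      show "m = card (J - {k})"
        using Suc.hyps(2) that by simp
      then show "J - {k} \<noteq> {}"
        using False by (metis card.empty)
    qed (use Suc.prems in auto)
    moreover have "m \<ge> 1"
      using False by simp
    ultimately show ?thesis
      using loomis_whitney_step[OF Suc.prems(1) Suc.hyps(2)[symmetric]] by blast
  qed
qed

section \<open>Return to renumbered coordinates and outer measure\<close>

lemma lborel_I_atLeastAtMost: "lborel_I {1..k} = lborel_xt k"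
  by (simp add: lborel_I_def lborel_xt_def)

lemma pairs_atLeastAtMost: "pairs n {1..n} = {1..2 * n}"
proof -
  have "pairs n {1..n} = {1..n} \<union> {n + 1..n + n}"
    unfolding pairs_def by (subst image_add_atLeastAtMost) simp
  then show ?thesis by auto
qed

text \<open>The preimage of a box is a box with the sides permuted, which has the same volume. With
  \<open>h\<close> skipping one index, this matches deletion by \<open>undefined\<close> with
  deletion by renumbering.\<close>

lemma distr_lborel_I_reindex:
  assumes "finite L" and h: "bij_betw h L L'"
  shows "(\<lambda>p. (\<lambda>i\<in>L. fst p (h i), snd p)) \<in> lborel_I L' \<rightarrow>\<^sub>M lborel_I L"
    and "distr (lborel_I L') (lborel_I L) (\<lambda>p. (\<lambda>i\<in>L. fst p (h i), snd p)) = lborel_I L"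
proof -
  let ?P = "\<lambda>L. (\<Pi>\<^sub>M i\<in>L. lborel) :: (nat \<Rightarrow> real) measure"
  have L': "finite L'" "L' = h ` L" "inj_on h L"
    using assms bij_betw_finite by (auto simp: bij_betw_def)
  have meas: "(\<lambda>x. \<lambda>i\<in>L. x (h i)) \<in> ?P L' \<rightarrow>\<^sub>M ?P L"
    using L' by (intro measurable_restrict measurable_component_singleton) auto
  have distr: "distr (?P L') (?P L) (\<lambda>x. \<lambda>i\<in>L. x (h i)) = ?P L"
  proof (rule lborel_prod.PiM_eqI)
    fix B :: "nat \<Rightarrow> real set" assume B: "\<And>i. i \<in> L \<Longrightarrow> B i \<in> sets lborel"
    define g where "g = the_inv_into L h"
    have gh: "g (h i) = i" if "i \<in> L" for i
      using L' that by (simp add: g_def the_inv_into_f_f)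
    have "(\<lambda>x. \<lambda>i\<in>L. x (h i)) -` Pi\<^sub>E L B \<inter> space (?P L') = Pi\<^sub>E L' (\<lambda>j. B (g j))"
      using gh by (auto simp: L' space_PiM PiE_iff)
    then have "emeasure (distr (?P L') (?P L) (\<lambda>x. \<lambda>i\<in>L. x (h i))) (Pi\<^sub>E L B) =
        emeasure (?P L') (Pi\<^sub>E L' (\<lambda>j. B (g j)))"
      using B assms by (subst emeasure_distr[OF meas]) (auto intro!: sets_PiM_I_finite)
    also have "\<dots> = (\<Prod>j\<in>L'. emeasure lborel (B (g j)))"
      using L' gh B by (intro lborel_prod.emeasure_PiM) auto
    also have "\<dots> = (\<Prod>i\<in>L. emeasure lborel (B i))"
      using L' gh by (simp add: prod.reindex)
    finally show "emeasure (distr (?P L') (?P L) (\<lambda>x. \<lambda>i\<in>L. x (h i))) (Pi\<^sub>E L B) =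
      (\<Prod>i\<in>L. emeasure lborel (B i))" .
  qed (use assms in auto)
  show "(\<lambda>p. (\<lambda>i\<in>L. fst p (h i), snd p)) \<in> lborel_I L' \<rightarrow>\<^sub>M lborel_I L"
    unfolding lborel_I_def
    by (intro measurable_Pair measurable_compose[OF measurable_fst meas] measurable_snd)
  have pair: "distr (?P L') (?P L) (\<lambda>x. \<lambda>i\<in>L. x (h i)) \<Otimes>\<^sub>M distr lborel lborel (\<lambda>t::real. t) =
      distr (?P L' \<Otimes>\<^sub>M lborel) (?P L \<Otimes>\<^sub>M lborel) (\<lambda>(x, t). (\<lambda>i\<in>L. x (h i), t))"
    by (rule pair_measure_distr[OF meas]) (auto simp: distr_id2 sigma_finite_lborel)
  show "distr (lborel_I L') (lborel_I L) (\<lambda>p. (\<lambda>i\<in>L. fst p (h i), snd p)) = lborel_I L"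
    using pair[symmetric] unfolding lborel_I_def distr by (simp add: distr_id2 case_prod_unfold)
qed

text \<open>This is the index shift of \<open>del_coord\<close>; for its inverse the case
  \<open>l = i\<close> does not occur.\<close>

lemma bij_betw_skip:
  fixes i m :: nat
  assumes "i \<in> {1..m}"
  shows "bij_betw (\<lambda>l. if l < i then l else l + 1) {1..m - 1} ({1..m} - {i})"
  using assms by (intro bij_betwI[where g = "\<lambda>l. if l < i then l else l - 1"]) (auto split: if_splits)

text \<open>The renumbering skips position \<open>i\<close>, so the \<open>undefined\<close> stored
  there is never read.\<close>

lemma vproj_eq:
  assumes "i \<in> {1..2 * n}"
  shows "vproj n i p =
    (\<lambda>l\<in>{1..2 * n - 1}. fst (vproj_upd n i p) (if l < i then l else l + 1), snd (vproj_upd n i p))"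
  by (cases p) (auto simp: vproj_def vproj_upd_def del_coord_def restrict_def)

theorem theorem1p5:
  fixes n :: nat
  assumes "n \<ge> 1"
  shows "\<exists>C::real. C > 0 \<and>
    (\<forall>K. K \<subseteq> pts (2 * n) \<longrightarrow>
      leb_outer (2 * n) K \<le>
        ennreal C *
        (\<Prod>j = 1..2 * n.
           ennpowr (leb_outer (2 * n - 1) (vproj n j ` K))
             ((real n + 1) / (real n * (2 * real n + 1)))))"
proof (intro exI conjI allI impI)
  \<comment> \<open>The constant of the case of one pair survives every induction step, so 3 works
    for all \<open>n\<close>.\<close>
  show "(3 :: real) > 0" by simp
  fix K assume K: "K \<subseteq> pts (2 * n)"
  \<comment> \<open>As \<open>K\<close> is arbitrary, each projection is replaced by a measurable
    cover attaining its outer measure.\<close>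
  have "\<exists>E\<in>sets (lborel_xt (2 * n - 1)). vproj n i ` K \<subseteq> E \<and>
      leb_outer (2 * n - 1) (vproj n i ` K) = emeasure (lborel_xt (2 * n - 1)) E" for i
    unfolding leb_outer_def
    by (rule outer_measure_of_attain) (simp add: space_lborel_xt image_subset_iff vproj_mem_pts del: One_nat_def)
  then obtain E where E: "\<And>i. E i \<in> sets (lborel_I {1..2 * n - 1})" "\<And>i. vproj n i ` K \<subseteq> E i"
      "\<And>i. leb_outer (2 * n - 1) (vproj n i ` K) = emeasure (lborel_I {1..2 * n - 1}) (E i)"
    unfolding lborel_I_atLeastAtMost by metis
  define T where "T i p = (\<lambda>l\<in>{1..2 * n - 1}. fst p (if l < i then l else l + 1), snd p)"
    for i and p :: "(nat \<Rightarrow> real) \<times> real"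
  \<comment> \<open>The cover is pulled back to coordinates without renumbering; its measure is
    unchanged because \<open>T i\<close> preserves measure.\<close>
  define A where "A i = T i -` E i \<inter> space (lborel_I ({1..2 * n} - {i}))" for i
  have T: "T i \<in> lborel_I ({1..2 * n} - {i}) \<rightarrow>\<^sub>M lborel_I {1..2 * n - 1}"
    "distr (lborel_I ({1..2 * n} - {i})) (lborel_I {1..2 * n - 1}) (T i) = lborel_I {1..2 * n - 1}"
    if "i \<in> {1..2 * n}" for i
    using distr_lborel_I_reindex[OF _ bij_betw_skip[OF that]] unfolding T_def by auto
  have A: "A i \<in> sets (lborel_I ({1..2 * n} - {i}))"
    and A_emeasure: "emeasure (lborel_I ({1..2 * n} - {i})) (A i) = leb_outer (2 * n - 1) (vproj n i ` K)"
    if "i \<in> {1..2 * n}" for i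
    using measurable_sets[OF T(1)[OF that] E(1)[of i]] emeasure_distr[OF T(1)[OF that] E(1)[of i]]
      T(2)[OF that] E(3)[of i]
    by (simp_all only: A_def)
  have "K \<subseteq> vproj_inter n {1..n} A"
  proof
    fix p assume p: "p \<in> K"
    then have pts: "p \<in> space (lborel_I {1..2 * n})"
      using K unfolding lborel_I_atLeastAtMost space_lborel_xt by blast
    have "vproj_upd n i p \<in> A i" if i: "i \<in> {1..2 * n}" for i
    proof -
      have "T i (vproj_upd n i p) \<in> E i"
        using E(2)[of i] p unfolding T_def vproj_eq[OF i, symmetric] by blast
      moreover have "vproj_upd n i p \<in> space (lborel_I ({1..2 * n} - {i}))"
        using pts by (auto simp: vproj_upd_def space_lborel_I PiE_iff extensional_def)
      ultimately show ?thesis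
        by (simp add: A_def)
    qed
    then show "p \<in> vproj_inter n {1..n} A"
      using pts unfolding mem_vproj_inter_iff pairs_atLeastAtMost by blast
  qed
  moreover have "vproj_inter n {1..n} A \<in> sets (lborel_I (pairs n {1..n}))"
    by (rule sets_vproj_inter) (simp_all add: pairs_atLeastAtMost A del: One_nat_def)
  \<comment> \<open>\<open>K\<close> may be non-measurable, so its outer measure is compared with
    the measure of the measurable set containing it.\<close>
  ultimately have "leb_outer (2 * n) K \<le> emeasure (lborel_I (pairs n {1..n})) (vproj_inter n {1..n} A)"
    unfolding leb_outer_def lborel_I_atLeastAtMost[symmetric] pairs_atLeastAtMost
    by (metis outer_measure_of_eq outer_measure_of_mono)
  also have "\<dots> \<le> 3 * (\<Prod>i\<in>pairs n {1..n}. ennpowr (emeasure (lborel_I (pairs n {1..n} - {i})) (A i))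
         ((real n + 1) / (real n * (2 * real n + 1))))"
  proof -
    have "loomis_whitney n {1..n}"
      using assms by (intro loomis_whitney_all) auto
    from this[unfolded loomis_whitney_def, rule_format, of A] show ?thesis
      using A by (simp add: pairs_atLeastAtMost del: One_nat_def)
  qed
  also have "\<dots> = ennreal 3 * (\<Prod>j = 1..2 * n.
           ennpowr (leb_outer (2 * n - 1) (vproj n j ` K)) ((real n + 1) / (real n * (2 * real n + 1))))"
    unfolding pairs_atLeastAtMost
    by (intro arg_cong2[where f = "(*)"] prod.cong) (simp_all add: A_emeasure del: One_nat_def)
  finally show "leb_outer (2 * n) K \<le> ennreal 3 * (\<Prod>j = 1..2 * n.
           ennpowr (leb_outer (2 * n - 1) (vproj n j ` K)) ((real n + 1) / (real n * (2 * real n + 1))))" .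
qed

end
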